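(* Let $\rho=3-2\sqrt2$. For $0\le r\le n$, the average depth of the $r$th leaf over all Schröder trees with $n+1$ leaves equals $$\frac{(r+1)s_{n+1}}{2s_n}+\frac{r-1}{2}-\frac{2}{s_n}\sum_{i=0}^{r-1}(r-i)s_is_{n-i}.$$ As $n\to\infty$, this average is asymptotically equal to $$(2+\sqrt{2})(r+1)-1-2\sum_{i=0}^{r-1}(r-i)\rho^{i} s_{i} =\frac{\rho^{r-1}}{2}\binom{r+2}{2}s_{r+1}-\rho^r\binom{r+1}{2}s_{r}+\frac{\rho^{r+1}}{2}\binom{r}{2}s_{r-1}-\frac{1}{2}$$ if $r$ is fixed, and to $$\frac{\sqrt{1-\rho^2}}{\rho\sqrt{\pi}}\sqrt{r\left(1-\frac{r}{n}\right)}$$ if $r=r(n)$ is such that $r\to\infty$ and $n-r\to\infty$.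
   Context: A plane tree is a rooted tree where the children of each node are linearly ordered. A Schröder tree is a plane tree where every internal (non-leaf) node has at least two children (the single-node tree is allowed and has one leaf). The leaves are ordered from left to right and indexed starting at $0$, so that the leftmost leaf is the $0$th leaf. The depth of a leaf is the number of edges in the path from the root to it. $s_n$ denotes the $n$th little Schröder number, which is the number of Schröder trees with $n+1$ leaves: $$\sum_{n\ge0}s_nz^n=\frac{1+z-\sqrt{1-6z+z^2}}{4z}=1+z+3z^2+11z^3+\cdots.$$ When $r=0$ the term containing $s_{r-1}$ is $0$ because $\binom{0}{2}=0$. Averages are over the uniform distribution on Schröder trees with $n+1$ leaves. For fixed $r$, "asymptotically equal" means that the average converges to the displayed constant; when $r=r(n)$ varies, it means that the ratio of the two quantities tends to $1$. *)

theory Defs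
  imports Complex_Main "HOL-Library.Landau_Symbols"
begin

datatype plane_tree = Node "plane_tree list"

fun schroeder :: "plane_tree \<Rightarrow> bool" where
  "schroeder (Node ts) \<longleftrightarrow> (ts = [] \<or> length ts \<ge> 2) \<and> (\<forall>t\<in>set ts. schroeder t)"

fun num_leaves :: "plane_tree \<Rightarrow> nat" where
  "num_leaves (Node ts) = (if ts = [] then 1 else sum_list (map num_leaves ts))"

text \<open>The depths of all leaves, listed from left to right: passing from a child of the root to the
  root adds one edge to every path.\<close>

fun leaf_depths :: "plane_tree \<Rightarrow> nat list" where
  "leaf_depths (Node ts) = (if ts = [] then [0] else map Suc (concat (map leaf_depths ts)))"

lemma length_leaf_depths: "length (leaf_depths t) = num_leaves t"
  by (induction t rule: leaf_depths.induct)
    (auto simp: length_concat comp_def intro!: arg_cong[of _ _ sum_list])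

text \<open>Leaves are indexed from 0; the value is meaningful only for \<open>r < num_leaves t\<close>.\<close>

definition leaf_depth :: "plane_tree \<Rightarrow> nat \<Rightarrow> nat" where
  "leaf_depth t r = leaf_depths t ! r"

definition schroeder_trees :: "nat \<Rightarrow> plane_tree set" where
  "schroeder_trees n = {t. schroeder t \<and> num_leaves t = n + 1}"

definition little_schroeder :: "nat \<Rightarrow> nat" where
  "little_schroeder n = card (schroeder_trees n)"

definition avg_leaf_depth :: "nat \<Rightarrow> nat \<Rightarrow> real" where
  "avg_leaf_depth n r =
    (\<Sum>t\<in>schroeder_trees n. real (leaf_depth t r)) / real (card (schroeder_trees n))"

end

theory Submission
  imports Defs "HOL-Analysis.Analysis" "HOL-Real_Asymp.Real_Asymp"
begin

text \<open>
  The depth of a leaf, plus one, is the number of nodes on the path to it, and each of these nodes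
  cuts the tree into two trees with a marked leaf: the subtree at the node, and the tree that is left
  when the node itself becomes a leaf. The cut is reversible, so if \<open>s\<^sub>n\<close> trees have \<open>n + 1\<close> leaves, and
  \<open>M = \<Sum> s\<^bsub>r+k\<^esub> x\<^sup>r y\<^sup>k\<close> counts trees with a marked leaf that has \<open>r\<close> leaves on its left and \<open>k\<close> on
  its right, then the sums of depth plus one have the generating function \<open>M\<^sup>2\<close>. Instead of the
  bijection, the proof shows that both series solve a linear equation with the same coefficient:
  splitting off the first subtree of the root gives \<open>K M = 1 - x S(x)\<close> for the trees and
  \<open>K E = M (1 - x S(x))\<close> for the depth sums \<open>E\<close>, hence \<open>E = M\<^sup>2\<close> (\<open>path_gf_eq_square\<close>).

  The coefficients of \<open>M\<^sup>2\<close> are sums of \<open>s\<^bsub>i+j\<^esub> s\<^bsub>n-i-j\<^esub>\<close> over a rectangle. The symmetry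
  \<open>m \<mapsto> n - m\<close> and the convolution identity \<open>2 \<Sum> s\<^sub>i s\<^bsub>n-i\<^esub> = s\<^bsub>n+1\<^esub> + s\<^sub>n\<close> turn them into the exact
  formula (\<open>avg_leaf_depth_shifted_depth\<close>).

  The remaining sum over \<open>i < r\<close> also has a closed form. Let \<open>k = n - r\<close> and
  \<open>U\<^sub>m = (m+2 choose 2) s\<^bsub>m+1\<^esub>\<close>, \<open>V\<^sub>m = (m+1 choose 2) s\<^sub>m\<close>, \<open>W\<^sub>m = (m choose 2) s\<^bsub>m-1\<^esub>\<close>. Then the average
  depth plus 1/2, multiplied by \<open>s\<^sub>n\<close>, is
    \<open>U\<^sub>r U\<^sub>k / ((n+1)(n+2)) - 2 V\<^sub>r V\<^sub>k / (n(n+2)) + W\<^sub>r W\<^sub>k / (n(n+1))\<close>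
  (\<open>shifted_depth_partial_fractions\<close>). As functions of \<open>r\<close> both sides have the second difference
  \<open>-2 s\<^bsub>r+1\<^esub> s\<^bsub>n-r-1\<^esub>\<close>; for the closed form this is a consequence of the three-term recurrence of \<open>s\<close>,
  which in turn expresses that \<open>1 + z - 4 z S(z)\<close> is the square root of \<open>1 - 6 z + z\<^sup>2\<close>.

  For fixed \<open>r\<close>, only \<open>s\<^bsub>n-i\<^esub> / s\<^sub>n \<longlonglongrightarrow> \<rho>\<^sup>i\<close> is needed. The exact formula and the closed form yield the
  two expressions for the limit, which therefore agree.

  For varying \<open>r\<close>, one needs \<open>s\<^sub>n \<sim> C \<rho>\<^bsup>-n\<^esup> n\<^bsup>-3/2\<^esup>\<close>. It follows from
  \<open>1 - 6 z + z\<^sup>2 = (1 - \<rho> z) (1 - z / \<rho>)\<close>: the coefficients of the square root of the first factor are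
  negligible against those of the second, so that the first factor contributes only its value
  \<open>sqrt (1 - \<rho>\<^sup>2)\<close> at \<open>z = \<rho>\<close>. Inserted into the closed form, this gives
  \<open>C / 4 (1/\<rho> - \<rho>)\<^sup>2 sqrt (r k / n)\<close>. As \<open>(1/\<rho> - \<rho>)\<^sup>2 = 32\<close>, the constant is \<open>8 C\<close>.
\<close>

unbundle no vec_syntax and fps_syntax

section \<open>Splitting off the first subtree of the root\<close>

lemma num_leaves_pos: "num_leaves t > 0"
proof (induction t)
  case (Node ts)
  show ?case
  proof (cases ts)
    case (Cons t us)
    then have "0 < num_leaves t" using Node by simp
    then show ?thesis using Cons by simp
  qed simp
qed

lemma schroeder_trees_0: "schroeder_trees 0 = {Node []}"
proof -
  have "t = Node []" if "schroeder t" "num_leaves t = 1" for t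
  proof (cases t)
    case (Node ts)
    show ?thesis
    proof (rule ccontr)
      assume "t \<noteq> Node []"
      then have "length ts \<ge> 2" using that Node by auto
      then obtain a b us where ts: "ts = a # b # us"
        by (cases ts; cases "tl ts") auto
      show False
        using that(2) num_leaves_pos[of a] num_leaves_pos[of b] unfolding Node ts by simp
    qed
  qed
  then show ?thesis by (auto simp: schroeder_trees_def)
qed

fun children :: "plane_tree \<Rightarrow> plane_tree list" where
  "children (Node ts) = ts"

abbreviation splittings :: "nat \<Rightarrow> (nat \<times> plane_tree \<times> plane_tree) set" where
  "splittings n \<equiv> (SIGMA i:{..n}. schroeder_trees i \<times> schroeder_trees (n - i))"

text \<open>
  The children of the root after the first one are either a single tree \<open>u\<close>, or at least two trees,
  which are then the children of the root of another Schroeder tree \<open>u\<close>. So a tree with more than one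
  leaf is a pair \<open>(t, u)\<close> joined in one of two ways, and only the second way excludes that \<open>u\<close> is a leaf.
\<close>

lemma schroeder_trees_Suc:
  "schroeder_trees (Suc n) =
     (\<lambda>(i, t, u). Node [t, u]) ` splittings n
     \<union> (\<lambda>(i, t, u). Node (t # children u)) ` {(i, t, u) \<in> splittings n. u \<noteq> Node []}"
    (is "?L = ?B \<union> ?C")
proof (intro equalityI subsetI)
  fix x assume x: "x \<in> ?L"
  obtain ts where ts: "x = Node ts" by (cases x)
  have "ts \<noteq> []" using x by (auto simp: ts schroeder_trees_def)
  then have "length ts \<ge> 2" using x by (auto simp: ts schroeder_trees_def)
  then obtain t v vs where tv: "ts = t # v # vs"
    by (cases ts; cases "tl ts") auto
  define i where "i = num_leaves t - 1"
  have i: "num_leaves t = i + 1" using num_leaves_pos[of t] by (simp add: i_def)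
  have sch: "schroeder t" "schroeder v" "\<forall>w\<in>set vs. schroeder w"
    and lv: "i + num_leaves v + sum_list (map num_leaves vs) = Suc n"
    using x i by (auto simp: ts tv schroeder_trees_def)
  have i_le: "i \<le> n" using lv num_leaves_pos[of v] by linarith
  have t: "t \<in> schroeder_trees i" using sch i by (simp add: schroeder_trees_def)
  show "x \<in> ?B \<union> ?C"
  proof (cases vs)
    case Nil
    have "v \<in> schroeder_trees (n - i)" using sch lv i_le Nil by (simp add: schroeder_trees_def)
    with t i_le show ?thesis
      by (intro UnI1 image_eqI[of _ _ "(i, t, v)"]) (auto simp: ts tv Nil)
  next
    case (Cons w ws)
    have "Node (v # vs) \<in> schroeder_trees (n - i)"
      using sch lv i_le Cons by (simp add: schroeder_trees_def)
    with t i_le show ?thesis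
      by (intro UnI2 image_eqI[of _ _ "(i, t, Node (v # vs))"]) (auto simp: ts tv)
  qed
next
  fix x assume "x \<in> ?B \<union> ?C"
  then show "x \<in> ?L"
  proof
    assume "x \<in> ?B"
    then show ?thesis by (auto simp: schroeder_trees_def)
  next
    assume "x \<in> ?C"
    then obtain i t us where "i \<le> n" "t \<in> schroeder_trees i" "Node us \<in> schroeder_trees (n - i)"
      "us \<noteq> []" "x = Node (t # us)"
      by (auto, metis children.cases children.simps)
    then show ?thesis by (auto simp: schroeder_trees_def)
  qed
qed

lemma finite_schroeder_trees: "finite (schroeder_trees n)"
proof (induction n rule: less_induct)
  case (less n)
  show ?case
  proof (cases n)
    case 0
    then show ?thesis by (simp add: schroeder_trees_0)
  next
    case (Suc m)
    have fin: "finite (splittings m)" using less Suc by (intro finite_SigmaI finite_cartesian_product) auto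
    then have "finite {(i, t, u) \<in> splittings m. u \<noteq> Node []}" by (rule rev_finite_subset) auto
    with fin show ?thesis unfolding Suc schroeder_trees_Suc by blast
  qed
qed

lemma sum_schroeder_trees_Suc:
  fixes f :: "plane_tree \<Rightarrow> real"
  shows "(\<Sum>x\<in>schroeder_trees (Suc n). f x) =
    (\<Sum>i\<le>n. \<Sum>t\<in>schroeder_trees i. \<Sum>u\<in>schroeder_trees (n - i).
       f (Node [t, u]) + (if u = Node [] then 0 else f (Node (t # children u))))"
proof -
  let ?g = "\<lambda>(i::nat, t, u). Node [t, u]" and ?h = "\<lambda>(i::nat, t, u). Node (t # children u)"
  let ?S = "splittings n" and ?S' = "{(i, t, u) \<in> splittings n. u \<noteq> Node []}"
  have fin: "finite ?S" by (intro finite_SigmaI finite_cartesian_product finite_schroeder_trees) auto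
  then have fin': "finite ?S'" by (rule rev_finite_subset) auto
  have idx: "i = num_leaves t - 1" if "t \<in> schroeder_trees i" for i t
    using that by (simp add: schroeder_trees_def)
  have inj: "inj_on ?g ?S"
    by (auto simp: inj_on_def dest!: idx)
  have inj': "inj_on ?h ?S'"
    by (auto simp: inj_on_def dest!: idx elim: children.elims)
  have len: "length (children u) \<ge> 2" if "u \<in> schroeder_trees j" "u \<noteq> Node []" for u j
    using that by (cases u) (auto simp: schroeder_trees_def)
  have disj: "?g ` ?S \<inter> ?h ` ?S' = {}"
  proof (intro equals0I, elim IntE imageE)
    fix x p q assume "x = ?g p" "x = ?h q" "q \<in> ?S'"
    then show False by (cases p; cases q) (auto dest: len)
  qed
  have "(\<Sum>x\<in>schroeder_trees (Suc n). f x) = sum f (?g ` ?S) + sum f (?h ` ?S')"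
    unfolding schroeder_trees_Suc using fin fin' disj by (intro sum.union_disjoint) auto
  also have "\<dots> = (\<Sum>(i, t, u)\<in>?S. f (Node [t, u])) + (\<Sum>(i, t, u)\<in>?S'. f (Node (t # children u)))"
    unfolding sum.reindex[OF inj] sum.reindex[OF inj'] by (simp add: case_prod_unfold o_def)
  also have "(\<Sum>(i, t, u)\<in>?S'. f (Node (t # children u)))
      = (\<Sum>(i, t, u)\<in>?S. if u = Node [] then 0 else f (Node (t # children u)))"
    using fin by (intro sum.mono_neutral_cong_left) (auto split: if_splits)
  finally show ?thesis
    by (simp add: sum.Sigma finite_schroeder_trees flip: sum.distrib)
      (simp add: case_prod_unfold flip: sum.distrib)
qed

abbreviation schr :: "nat \<Rightarrow> real" where
  "schr n \<equiv> real (little_schroeder n)"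

lemma schr_0: "schr 0 = 1"
  by (simp add: little_schroeder_def schroeder_trees_0)

lemma card_schroeder_trees [simp]: "card (schroeder_trees n) = little_schroeder n"
  by (simp add: little_schroeder_def)

lemma sum_schroeder_trees_const: "(\<Sum>t\<in>schroeder_trees n. c) = schr n * c" for c :: real
  by simp

text \<open>
  The single leaf is the only tree that admits one way of joining instead of two; here it is separated
  from all other trees in a sum.
\<close>

lemma sum_if_leaf:
  "(\<Sum>u\<in>schroeder_trees n. if u = Node [] then c else d) = schr n * d + (if n = 0 then c - d else 0)"
  for c d :: real
proof (cases "n = 0")
  case True
  then show ?thesis by (simp add: schroeder_trees_0 schr_0)
next
  case False
  then have "u \<noteq> Node []" if "u \<in> schroeder_trees n" for u
    using that by (auto simp: schroeder_trees_def)
  then have "(\<Sum>u\<in>schroeder_trees n. if u = Node [] then c else d) = (\<Sum>u\<in>schroeder_trees n. d)"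
    by (intro sum.cong) auto
  then show ?thesis using False by (simp add: sum_schroeder_trees_const)
qed

text \<open>
  Every pair of trees is joined in two ways, apart from the pairs whose second member is a leaf.
\<close>

lemma schr_Suc: "schr (Suc n) = 2 * (\<Sum>i\<le>n. schr i * schr (n - i)) - schr n"
proof -
  have "schr (Suc n) = (\<Sum>i\<le>n. \<Sum>t\<in>schroeder_trees i. \<Sum>u\<in>schroeder_trees (n - i).
       1 + (if u = Node [] then 0 else 1))"
    using sum_schroeder_trees_Suc[of "\<lambda>_. 1" n] by (simp add: sum_schroeder_trees_const)
  also have "\<dots> = (\<Sum>i\<le>n. schr i * (2 * schr (n - i) - (if n - i = 0 then 1 else 0)))"
    by (simp add: sum.distrib sum_schroeder_trees_const sum_if_leaf cong: if_cong)
      (intro sum.cong, auto)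
  also have "\<dots> = (\<Sum>i\<le>n. 2 * (schr i * schr (n - i)) - (if i = n then schr n else 0))"
    by (intro sum.cong) (auto simp: algebra_simps)
  finally show ?thesis by (simp add: sum_subtractf sum_distrib_left)
qed

lemma leaf_depth_binary:
  assumes "r < num_leaves t + num_leaves u"
  shows "leaf_depth (Node [t, u]) r =
     (if r < num_leaves t then Suc (leaf_depth t r) else Suc (leaf_depth u (r - num_leaves t)))"
  using assms by (auto simp: leaf_depth_def nth_append length_leaf_depths)

lemma leaf_depth_graft:
  assumes "u \<noteq> Node []"
  shows "leaf_depth (Node (t # children u)) r =
     (if r < num_leaves t then Suc (leaf_depth t r) else leaf_depth u (r - num_leaves t))"
  using assms by (cases u) (auto simp: leaf_depth_def nth_append length_leaf_depths)

lemma leaf_depth_leaf: "leaf_depth (Node []) 0 = 0"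
  by (simp add: leaf_depth_def)

section \<open>Sums of depths and their generating function\<close>

text \<open>
  The sum runs over the trees with a marked leaf that has \<open>r\<close> leaves on its left and \<open>k\<close> on its right.
  Adding one to the depth counts the nodes on the path to the leaf.
\<close>

definition path_sum :: "nat \<Rightarrow> nat \<Rightarrow> real" where
  "path_sum r k = (\<Sum>t\<in>schroeder_trees (r + k). real (leaf_depth t r) + 1)"

lemma path_sum_0_0: "path_sum 0 0 = 1"
  by (simp add: path_sum_def schroeder_trees_0 leaf_depth_leaf)

lemma sum_split_reverse:
  fixes f :: "nat \<Rightarrow> real"
  shows "(\<Sum>i<r + k. f i) = (\<Sum>i<r. f i) + (\<Sum>j<k. f (r + k - 1 - j))"
proof -
  have "(\<Sum>i<r + k. f i) = (\<Sum>i<r. f i) + (\<Sum>j<k. f (r + j))"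
    by (induction k) auto
  also have "(\<Sum>j<k. f (r + j)) = (\<Sum>j<k. f (r + k - 1 - j))"
    by (subst sum.nat_diff_reindex[symmetric]) (intro sum.cong, auto)
  finally show ?thesis .
qed

text \<open>
  In a tree made of \<open>t\<close> and \<open>u\<close>, a leaf of \<open>t\<close> is one level deeper than it was in \<open>t\<close>, whichever way they
  are joined. A leaf of \<open>u\<close> is one level deeper in the binary tree, but keeps its depth when \<open>t\<close> becomes
  an additional first child of the root of \<open>u\<close>.
\<close>

lemma path_sum_rec:
  assumes "r + k > 0"
  shows "path_sum r k = schr (r + k)
    + 2 * (\<Sum>j<k. schr j * path_sum r (k - 1 - j)) - (if k = 0 then 0 else path_sum r (k - 1))
    + 2 * (\<Sum>i<r. schr i * path_sum (r - 1 - i) k) - (\<Sum>i<r. schr i * schr (r - 1 - i + k))"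
proof -
  obtain n where n: "r + k = Suc n" using assms by (cases "r + k") auto
  let ?d = "\<lambda>t r. real (leaf_depth t r)"
  define h where "h i = (\<Sum>t\<in>schroeder_trees i. \<Sum>u\<in>schroeder_trees (n - i).
       ?d (Node [t, u]) r + (if u = Node [] then 0 else ?d (Node (t # children u)) r))" for i
  have right: "h i = schr i * (2 * path_sum (r - 1 - i) k - schr (r - 1 - i + k))" if "i < r" for i
  proof -
    have len: "num_leaves t = i + 1" if "t \<in> schroeder_trees i" for t i
      using that by (simp add: schroeder_trees_def)
    have "h i = (\<Sum>t\<in>schroeder_trees i. \<Sum>u\<in>schroeder_trees (n - i). 2 * (?d u (r - 1 - i) + 1) - 1)"
      unfolding h_def
    proof (intro sum.cong refl)
      fix t u assume t: "t \<in> schroeder_trees i" and u: "u \<in> schroeder_trees (n - i)"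
      have "num_leaves t + num_leaves u = Suc (Suc n)"
        using len[OF t] len[OF u] \<open>i < r\<close> n by simp
      \<comment> \<open>If \<open>u\<close> is a leaf, there is only the binary tree; twice the depth plus one is still correct,
        since the leaf has depth 0 in \<open>u\<close>.\<close>
      moreover have "r - 1 - i = 0" if "u = Node []"
        using that len[OF u] \<open>i < r\<close> n by simp
      ultimately show "?d (Node [t, u]) r + (if u = Node [] then 0 else ?d (Node (t # children u)) r)
          = 2 * (?d u (r - 1 - i) + 1) - 1"
        using len[OF t] \<open>i < r\<close> n
        by (auto simp: leaf_depth_binary leaf_depth_graft leaf_depth_leaf)
    qed
    also have "\<dots> = schr i * (\<Sum>u\<in>schroeder_trees (n - i). 2 * (?d u (r - 1 - i) + 1) - 1)"
      by (simp only: sum_schroeder_trees_const)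
    also have "n - i = r - 1 - i + k" using that n by simp
    finally show ?thesis
      by (simp only: path_sum_def sum_subtractf sum_distrib_left[symmetric]
          sum_schroeder_trees_const mult_1_right)
  qed
  have left: "h (n - j) = (2 * schr j - (if j = 0 then 1 else 0)) * path_sum r (k - 1 - j)" if "j < k" for j
  proof -
    have j: "n - j = r + (k - 1 - j)" "n - (n - j) = j" using that n by auto
    have len: "num_leaves t = r + (k - 1 - j) + 1" if "t \<in> schroeder_trees (n - j)" for t
      using that j by (simp add: schroeder_trees_def)
    have "h (n - j) = (\<Sum>t\<in>schroeder_trees (n - j). \<Sum>u\<in>schroeder_trees j.
        (if u = Node [] then 1 else 2) * (?d t r + 1))"
      unfolding h_def j(2)
      by (intro sum.cong refl) (auto simp: leaf_depth_binary leaf_depth_graft len)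
    also have "\<dots> = (\<Sum>t\<in>schroeder_trees (n - j). (2 * schr j - (if j = 0 then 1 else 0)) * (?d t r + 1))"
      by (intro sum.cong refl) (simp only: sum_distrib_right[symmetric] sum_if_leaf, simp)
    finally show ?thesis
      unfolding j(1) path_sum_def by (simp add: sum_distrib_left)
  qed
  have "(\<Sum>t\<in>schroeder_trees (r + k). ?d t r) = (\<Sum>i\<le>n. h i)"
    unfolding n h_def by (rule sum_schroeder_trees_Suc)
  also have "\<dots> = (\<Sum>i<r + k. h i)" by (simp add: n lessThan_Suc_atMost)
  also have "\<dots> = (\<Sum>i<r. h i) + (\<Sum>j<k. h (r + k - 1 - j))" by (rule sum_split_reverse)
  also have "(\<Sum>i<r. h i)
      = 2 * (\<Sum>i<r. schr i * path_sum (r - 1 - i) k) - (\<Sum>i<r. schr i * schr (r - 1 - i + k))"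
    unfolding sum_subtractf[symmetric] sum_distrib_left
    by (intro sum.cong refl) (simp add: right algebra_simps)
  also have "(\<Sum>j<k. h (r + k - 1 - j))
      = 2 * (\<Sum>j<k. schr j * path_sum r (k - 1 - j)) - (\<Sum>j<k. if j = 0 then path_sum r (k - 1) else 0)"
    unfolding sum_subtractf[symmetric] sum_distrib_left
  proof (intro sum.cong refl)
    fix j assume "j \<in> {..<k}"
    moreover have "r + k - 1 - j = n - j" using n by simp
    ultimately show "h (r + k - 1 - j)
        = 2 * (schr j * path_sum r (k - 1 - j)) - (if j = 0 then path_sum r (k - 1) else 0)"
      by (auto simp: left algebra_simps)
  qed
  also have "(\<Sum>j<k. if j = 0 then path_sum r (k - 1) else 0) = (if k = 0 then 0 else path_sum r (k - 1))"
    by (cases k) (auto simp: lessThan_Suc_eq_insert_0 sum.delta)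
  moreover have "path_sum r k = (\<Sum>t\<in>schroeder_trees (r + k). ?d t r) + schr (r + k)"
    by (simp only: path_sum_def sum.distrib sum_schroeder_trees_const mult_1_right)
  ultimately show ?thesis by (simp only: algebra_simps)
qed

text \<open>
  The recurrence for the number of trees in the shape of the one for \<open>path_sum\<close>, with the pairs
  separated according to the subtree that contains leaf \<open>r\<close>. The pairs whose second member is a leaf
  lie in the first group if leaf \<open>r\<close> is not the last leaf, and in the second group otherwise.
\<close>

lemma schr_Suc_split:
  assumes "r + k > 0"
  shows "schr (r + k) =
    2 * (\<Sum>j<k. schr j * schr (r + (k - 1 - j))) - (if k = 0 then 0 else schr (r + (k - 1)))
    + 2 * (\<Sum>i<r. schr i * schr (r - 1 - i + k)) - (if k = 0 then schr (r - 1) else 0)"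
proof -
  obtain n where n: "r + k = Suc n" using assms by (cases "r + k") auto
  have "(\<Sum>i\<le>n. schr i * schr (n - i)) = (\<Sum>i<r + k. schr i * schr (n - i))"
    by (simp add: n lessThan_Suc_atMost)
  also have "\<dots> = (\<Sum>i<r. schr i * schr (n - i)) + (\<Sum>j<k. schr (n - j) * schr (n - (n - j)))"
    by (subst sum_split_reverse) (simp add: n)
  also have "(\<Sum>i<r. schr i * schr (n - i)) = (\<Sum>i<r. schr i * schr (r - 1 - i + k))"
    using n by (intro sum.cong refl) (auto intro!: arg_cong[of _ _ little_schroeder])
  also have "(\<Sum>j<k. schr (n - j) * schr (n - (n - j))) = (\<Sum>j<k. schr j * schr (r + (k - 1 - j)))"
  proof (intro sum.cong refl)
    fix j assume "j \<in> {..<k}"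
    then have "n - j = r + (k - 1 - j)" "n - (n - j) = j" using n by auto
    then show "schr (n - j) * schr (n - (n - j)) = schr j * schr (r + (k - 1 - j))" by simp
  qed
  finally have "schr (Suc n) = 2 * ((\<Sum>i<r. schr i * schr (r - 1 - i + k)) + (\<Sum>j<k. schr j * schr (r + (k - 1 - j)))) - schr n"
    by (simp only: schr_Suc)
  moreover have "schr n = (if k = 0 then 0 else schr (r + (k - 1))) + (if k = 0 then schr (r - 1) else 0)"
    using n by (cases k) auto
  ultimately show ?thesis
    unfolding n by (simp only: algebra_simps)
qed

text \<open>
  The outer variable \<open>x\<close> marks leaves on the left of the marked leaf, the inner variable \<open>y\<close> leaves on
  its right. Below, \<open>left_gf\<close> and \<open>right_gf\<close> are \<open>x S(x)\<close> and \<open>y S(y)\<close>, which enumerate complete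
  subtrees on the left and on the right.
\<close>

definition marked_gf :: "(nat \<Rightarrow> nat \<Rightarrow> real) \<Rightarrow> real fps fps" where
  "marked_gf f = Abs_fps (\<lambda>r. Abs_fps (\<lambda>k. f r k))"

definition left_gf :: "real fps fps" where
  "left_gf = fps_X * Abs_fps (\<lambda>r. fps_const (schr r))"

definition right_gf :: "real fps fps" where
  "right_gf = fps_const (fps_X * Abs_fps schr)"

lemma marked_gf_nth: "marked_gf f $ r $ k = f r k"
  by (simp add: marked_gf_def)

lemma left_gf_mult_nth: "(left_gf * F) $ r $ k = (\<Sum>i<r. schr i * F $ (r - 1 - i) $ k)"
proof (cases r)
  case (Suc m)
  have "(left_gf * F) $ Suc m = (Abs_fps (\<lambda>r. fps_const (schr r)) * F) $ m"
    by (simp add: left_gf_def mult.assoc)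
  also have "\<dots> = (\<Sum>i\<le>m. fps_const (schr i) * F $ (m - i))"
    by (simp only: fps_mult_nth fps_nth_Abs_fps atLeast0AtMost)
  finally show ?thesis by (simp add: Suc fps_sum_nth lessThan_Suc_atMost)
qed (simp add: left_gf_def mult.assoc)

lemma right_gf_mult_nth: "(right_gf * F) $ r $ k = (\<Sum>j<k. schr j * F $ r $ (k - 1 - j))"
proof (cases k)
  case (Suc m)
  have "(right_gf * F) $ r $ Suc m = (Abs_fps schr * F $ r) $ m"
    by (simp add: right_gf_def mult.assoc)
  also have "\<dots> = (\<Sum>j\<le>m. schr j * F $ r $ (m - j))"
    by (simp only: fps_mult_nth fps_nth_Abs_fps atLeast0AtMost)
  finally show ?thesis by (simp add: Suc lessThan_Suc_atMost)
qed (simp add: right_gf_def mult.assoc)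

text \<open>
  Both recurrences above express the coefficient at \<open>x\<^sup>r y\<^sup>k\<close> by the same linear combination of
  earlier coefficients; the series \<open>kernel\<close> collects it.
\<close>

definition kernel :: "real fps fps" where
  "kernel = 1 + fps_const fps_X - 2 * right_gf - 2 * left_gf"

lemma kernel_mult_nth:
  "(kernel * F) $ r $ k = F $ r $ k + (if k = 0 then 0 else F $ r $ (k - 1))
     - 2 * (\<Sum>j<k. schr j * F $ r $ (k - 1 - j)) - 2 * (\<Sum>i<r. schr i * F $ (r - 1 - i) $ k)"
proof -
  have split: "kernel * F = F + fps_const fps_X * F - (right_gf * F + right_gf * F) - (left_gf * F + left_gf * F)"
    by (simp add: kernel_def algebra_simps)
  show ?thesis
    unfolding split fps_add_nth fps_sub_nth left_gf_mult_nth right_gf_mult_nth by simp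
qed

lemma kernel_nonzero: "kernel \<noteq> 0"
proof -
  have "(kernel * 1) $ 0 $ 0 = 1" by (subst kernel_mult_nth) simp
  then show ?thesis by auto
qed

lemma left_gf_nth: "left_gf $ r $ k = (if k = 0 \<and> r > 0 then schr (r - 1) else 0)"
  by (cases r) (simp_all add: left_gf_def)

lemma kernel_mult_leaves: "kernel * marked_gf (\<lambda>r k. schr (r + k)) = 1 - left_gf"
proof (intro fps_ext)
  fix r k
  show "(kernel * marked_gf (\<lambda>r k. schr (r + k))) $ r $ k = (1 - left_gf) $ r $ k"
  proof (cases "r + k > 0")
    case True
    then have "(1 - left_gf) $ r $ k = - (if k = 0 then schr (r - 1) else 0)"
      by (auto simp: left_gf_nth)
    then show ?thesis
      using schr_Suc_split[OF True] unfolding kernel_mult_nth marked_gf_nth by simp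
  next
    case False
    then show ?thesis
      unfolding kernel_mult_nth marked_gf_nth by (simp add: left_gf_nth schr_0)
  qed
qed

lemma kernel_mult_paths:
  "kernel * marked_gf path_sum = marked_gf (\<lambda>r k. schr (r + k)) * (1 - left_gf)"
proof (intro fps_ext)
  fix r k
  let ?M = "marked_gf (\<lambda>r k. schr (r + k))"
  have rhs: "(?M * (1 - left_gf)) $ r $ k = schr (r + k) - (\<Sum>i<r. schr i * schr (r - 1 - i + k))"
    by (simp add: right_diff_distrib mult.commute[of _ left_gf] left_gf_mult_nth marked_gf_nth)
  show "(kernel * marked_gf path_sum) $ r $ k = (?M * (1 - left_gf)) $ r $ k"
  proof (cases "r + k > 0")
    case True
    show ?thesis
      unfolding rhs kernel_mult_nth marked_gf_nth using path_sum_rec[OF True] by simp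
  next
    case False
    then show ?thesis
      unfolding rhs kernel_mult_nth marked_gf_nth by (simp add: path_sum_0_0 schr_0)
  qed
qed

lemma path_gf_eq_square: "marked_gf path_sum = marked_gf (\<lambda>r k. schr (r + k)) * marked_gf (\<lambda>r k. schr (r + k))"
proof -
  have "kernel * marked_gf path_sum = kernel * (marked_gf (\<lambda>r k. schr (r + k)) * marked_gf (\<lambda>r k. schr (r + k)))"
    by (simp add: kernel_mult_paths mult.left_commute flip: kernel_mult_leaves)
  then show ?thesis using kernel_nonzero by simp
qed

text \<open>
  The cut of a tree at a node of the path, read off from \<open>E = M\<^sup>2\<close>: \<open>i\<close> and \<open>j\<close> are the numbers of
  leaves on both sides of the marked leaf in one of the two parts.
\<close>

lemma path_sum_eq_convolution:
  "path_sum r k = (\<Sum>i\<le>r. \<Sum>j\<le>k. schr (i + j) * schr ((r - i) + (k - j)))"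
proof -
  have "path_sum r k = (marked_gf (\<lambda>r k. schr (r + k)) * marked_gf (\<lambda>r k. schr (r + k))) $ r $ k"
    by (simp flip: path_gf_eq_square add: marked_gf_nth)
  then show ?thesis
    by (simp add: fps_mult_nth marked_gf_nth fps_sum_nth atLeast0AtMost add.commute)
qed

section \<open>The exact formula\<close>

lemma sum_lessThan_add: "(\<Sum>i<m + k. f i) = (\<Sum>i<m. f i) + (\<Sum>j<k. f (m + j))"
  for f :: "nat \<Rightarrow> real"
  by (induction k) auto

lemma sum_partial_sums: "(\<Sum>i\<le>r. \<Sum>m<i. a m) = (\<Sum>m<r. (real r - real m) * a m)"
proof (induction r)
  case (Suc r)
  have "(\<Sum>m<Suc r. (real (Suc r) - real m) * a m)
      = (\<Sum>m<Suc r. (real r - real m) * a m) + (\<Sum>m<Suc r. a m)"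
    unfolding sum.distrib[symmetric] by (intro sum.cong) (auto simp: algebra_simps)
  with Suc show ?case by simp
qed simp

text \<open>
  In row \<open>i\<close>, the indices \<open>i + j\<close> miss the first \<open>i\<close> and the last \<open>r - i\<close> of all indices up to \<open>r + k\<close>.
  By symmetry, what is missing at the end is a partial sum from the start as well, and over all rows
  every partial sum occurs twice.
\<close>

lemma sum_grid_symmetric:
  fixes a :: "nat \<Rightarrow> real"
  assumes sym: "\<And>m. m \<le> r + k \<Longrightarrow> a (r + k - m) = a m"
  shows "(\<Sum>i\<le>r. \<Sum>j\<le>k. a (i + j))
    = (real r + 1) * (\<Sum>m\<le>r + k. a m) - 2 * (\<Sum>m<r. (real r - real m) * a m)"
proof -
  have row: "(\<Sum>j\<le>k. a (i + j)) = (\<Sum>m\<le>r + k. a m) - (\<Sum>m<i. a m) - (\<Sum>m<r - i. a m)"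
    if "i \<le> r" for i
  proof -
    have "(\<Sum>m\<le>r + k. a m) = (\<Sum>m<(i + Suc k) + (r - i). a m)"
      using that by (intro sum.cong) auto
    also have "\<dots> = (\<Sum>m<i + Suc k. a m) + (\<Sum>j<r - i. a ((i + Suc k) + (r - i) - 1 - j))"
      by (rule sum_split_reverse)
    also have "(\<Sum>j<r - i. a ((i + Suc k) + (r - i) - 1 - j)) = (\<Sum>j<r - i. a j)"
    proof (intro sum.cong refl)
      fix j assume "j \<in> {..<r - i}"
      then have "(i + Suc k) + (r - i) - 1 - j = r + k - j" "j \<le> r + k" using that by auto
      then show "a ((i + Suc k) + (r - i) - 1 - j) = a j" by (simp only: sym)
    qed
    also have "(\<Sum>m<i + Suc k. a m) = (\<Sum>m<i. a m) + (\<Sum>j<Suc k. a (i + j))"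
      by (rule sum_lessThan_add)
    finally show ?thesis by (simp only: lessThan_Suc_atMost)
  qed
  have "(\<Sum>i\<le>r. \<Sum>m<r - i. a m) = (\<Sum>i\<le>r. \<Sum>m<i. a m)"
    by (rule sum.reindex_bij_witness[where i = "\<lambda>i. r - i" and j = "\<lambda>i. r - i"]) auto
  then show ?thesis
    by (simp add: row sum_subtractf sum_partial_sums)
qed

lemma schr_convolution: "(\<Sum>i\<le>n. schr i * schr (n - i)) = (schr (Suc n) + schr n) / 2"
  using schr_Suc[of n] by simp

lemma schr_pos: "schr n > 0"
proof (induction n rule: less_induct)
  case (less n)
  show ?case
  proof (cases n)
    case (Suc m)
    have "(\<Sum>i\<le>m. schr i * schr (m - i)) \<ge> (\<Sum>i\<in>{m}. schr i * schr (m - i))"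
      by (intro sum_mono2) auto
    then have "schr n \<ge> schr m"
      using schr_Suc[of m] by (simp add: Suc schr_0)
    then show ?thesis using less[of m] Suc by simp
  qed (simp add: schr_0)
qed

text \<open>
  Half of \<open>s\<^sub>n\<close> is added to the sum of the depths because this sum, and not that of the depths or of
  their successors, is a combination of products \<open>s\<^bsub>r+a\<^esub> s\<^bsub>n-r+b\<^esub>\<close>.
\<close>

definition shifted_depth :: "nat \<Rightarrow> nat \<Rightarrow> real" where
  "shifted_depth n r = (real r + 1) / 2 * schr (Suc n) + real r / 2 * schr n
     - 2 * (\<Sum>i<r. (real r - real i) * (schr i * schr (n - i)))"

lemma avg_leaf_depth_shifted_depth:
  assumes "r \<le> n"
  shows "avg_leaf_depth n r = shifted_depth n r / schr n - 1 / 2"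
proof -
  define k where "k = n - r"
  have n: "n = r + k" using assms by (simp add: k_def)
  let ?a = "\<lambda>m. schr m * schr (r + k - m)"
  have "path_sum r k = (\<Sum>i\<le>r. \<Sum>j\<le>k. ?a (i + j))"
    unfolding path_sum_eq_convolution
  proof (intro sum.cong refl)
    fix i j assume "i \<in> {..r}" "j \<in> {..k}"
    then have "r - i + (k - j) = r + k - (i + j)" by auto
    then show "schr (i + j) * schr (r - i + (k - j)) = ?a (i + j)" by simp
  qed
  also have "\<dots> = (real r + 1) * (\<Sum>m\<le>r + k. ?a m) - 2 * (\<Sum>m<r. (real r - real m) * ?a m)"
    by (rule sum_grid_symmetric) (simp add: mult.commute)
  also have "\<dots> = shifted_depth n r + schr n / 2"
    unfolding schr_convolution shifted_depth_def n by (simp add: field_simps)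
  finally have "(\<Sum>t\<in>schroeder_trees n. real (leaf_depth t r)) = shifted_depth n r - schr n / 2"
    by (simp add: path_sum_def sum.distrib n)
  then show ?thesis
    using schr_pos[of n] by (simp add: avg_leaf_depth_def field_simps)
qed

section \<open>The three-term recurrence of the little Schroeder numbers\<close>

text \<open>
  Solving the quadratic equation for \<open>S\<close> gives \<open>S = (1 + z - sqrt (1 - 6 z + z\<^sup>2)) / (4 z)\<close>. This series is
  the square root in it.
\<close>

definition sqrt_gf :: "real fps" where
  "sqrt_gf = 1 + fps_X - 4 * fps_X * Abs_fps schr"

lemma sqrt_gf_nth: "sqrt_gf $ 0 = 1" "sqrt_gf $ Suc 0 = - 3" "sqrt_gf $ Suc (Suc n) = - 4 * schr (Suc n)"
  by (simp_all add: sqrt_gf_def numeral_fps_const mult.assoc schr_0)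

lemma sqrt_gf_square: "sqrt_gf ^ 2 = 1 - 6 * fps_X + fps_X ^ 2"
proof -
  let ?S = "Abs_fps schr" and ?X = "fps_X :: real fps"
  have S: "2 * ?X * ?S ^ 2 = ?S - 1 + ?X * ?S"
  proof (rule fps_ext)
    fix n
    show "(2 * ?X * ?S ^ 2) $ n = (?S - 1 + ?X * ?S) $ n"
    proof (cases n)
      case (Suc m)
      then show ?thesis
        by (simp add: power2_eq_square mult.assoc numeral_fps_const fps_mult_nth[of ?S] atLeast0AtMost schr_convolution)
    qed (simp add: mult.assoc schr_0)
  qed
  have "sqrt_gf ^ 2 = (1 + ?X) ^ 2 - 8 * ?X * ?S * (1 + ?X) + 8 * ?X * (2 * ?X * ?S ^ 2)"
    unfolding sqrt_gf_def by algebra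
  also have "\<dots> = 1 - 6 * ?X + ?X ^ 2"
    unfolding S by algebra
  finally show ?thesis .
qed

text \<open>
  The differential equation \<open>2 P f' = P' f\<close> of \<open>f = sqrt P\<close>. Comparing coefficients in it gives the
  three-term recurrence.
\<close>

lemma sqrt_gf_ODE: "(1 - 6 * fps_X + fps_X ^ 2) * fps_deriv sqrt_gf = (fps_X - 3) * sqrt_gf"
proof -
  have "fps_deriv (sqrt_gf ^ 2) = fps_deriv (1 - 6 * fps_X + fps_X ^ 2)"
    by (simp only: sqrt_gf_square)
  then have "2 * (sqrt_gf * fps_deriv sqrt_gf) = 2 * (fps_X - 3)"
    by (simp add: power2_eq_square algebra_simps)
  then have "sqrt_gf * fps_deriv sqrt_gf = fps_X - 3"
    by (simp only: mult_cancel_left) auto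
  then show ?thesis
    unfolding sqrt_gf_square[symmetric] by algebra
qed

lemma schr_three_term:
  "(real m + 3) * schr (m + 2) = 3 * (2 * real m + 3) * schr (m + 1) - real m * schr m"
proof -
  have "((1 - 6 * fps_X + fps_X ^ 2) * fps_deriv sqrt_gf) $ (m + 2) = ((fps_X - 3) * sqrt_gf) $ (m + 2)"
    by (simp only: sqrt_gf_ODE)
  then show ?thesis
    by (cases m) (simp_all add: power2_eq_square ring_distribs mult.assoc numeral_fps_const sqrt_gf_nth schr_0)
qed

section \<open>A closed form for the average depth\<close>

text \<open>
  These are \<open>(r+2 choose 2) s\<^bsub>r+1\<^esub>\<close>, \<open>(r+1 choose 2) s\<^sub>r\<close> and \<open>(r choose 2) s\<^bsub>r-1\<^esub>\<close>, written with real
  polynomials, since the identities below are polynomial in \<open>r\<close>. At \<open>r = 0\<close> the truncated index in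
  \<open>lower\<close> is harmless because the coefficient vanishes.
\<close>

definition upper :: "nat \<Rightarrow> real" where "upper r = (real r + 2) * (real r + 1) / 2 * schr (r + 1)"
definition middle :: "nat \<Rightarrow> real" where "middle r = (real r + 1) * real r / 2 * schr r"
definition lower :: "nat \<Rightarrow> real" where "lower r = real r * (real r - 1) / 2 * schr (r - 1)"

text \<open>
  The closed form multiplied by \<open>n (n + 1) (n + 2)\<close> for \<open>n = r + k\<close>, which keeps the coefficients
  polynomial.
\<close>

definition product_form :: "nat \<Rightarrow> nat \<Rightarrow> real" where
  "product_form r k = real (r + k) * (upper r * upper k) - 2 * (real (r + k) + 1) * (middle r * middle k)
     + (real (r + k) + 2) * (lower r * lower k)"

lemma lower_Suc: "lower (Suc r) = middle r"
  by (simp add: lower_def middle_def)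

lemma middle_Suc: "middle (Suc r) = upper r"
  by (simp add: middle_def upper_def add.commute)

lemma upper_Suc: "2 * upper (Suc r) = (real r + 2) * (3 * (2 * real r + 3) * schr (r + 1) - real r * schr r)"
proof -
  have "2 * upper (Suc r) = (real r + 2) * ((real r + 3) * schr (r + 2))"
    by (simp add: upper_def algebra_simps)
  then show ?thesis by (simp only: schr_three_term)
qed

lemma upper_Suc_Suc:
  "2 * upper (r + 2) = 3 * (2 * real r + 5) * (3 * (2 * real r + 3) * schr (r + 1) - real r * schr r)
     - (real r + 3) * (real r + 1) * schr (r + 1)"
proof -
  have "2 * upper (r + 2) = (real r + 3) * ((real (r + 1) + 3) * schr (r + 1 + 2))"
    by (simp add: upper_def algebra_simps numeral_eq_Suc)
  also have "\<dots> = (real r + 3) * (3 * (2 * real r + 5) * schr (r + 2) - (real r + 1) * schr (r + 1))"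
    unfolding schr_three_term[of "r + 1"] by (simp add: algebra_simps numeral_eq_Suc)
  also have "\<dots> = 3 * (2 * real r + 5) * ((real r + 3) * schr (r + 2))
      - (real r + 3) * (real r + 1) * schr (r + 1)"
    by (simp only: algebra_simps)
  finally show ?thesis by (simp only: schr_three_term)
qed

lemma lower_eq: "2 * lower r = real r * (3 * (2 * real r + 1) * schr r - (real r + 2) * schr (r + 1))"
proof (cases r)
  case (Suc m)
  have "2 * lower (Suc m) = (real m + 1) * (real m * schr m)"
    by (simp add: lower_def add.commute)
  also have "real m * schr m = 3 * (2 * real m + 3) * schr (m + 1) - (real m + 3) * schr (m + 2)"
    by (simp only: schr_three_term)
  finally show ?thesis by (simp add: Suc add.commute)
qed (simp add: lower_def)

text \<open>
  The recurrence expresses all nine terms in \<open>r\<close> by \<open>s\<^sub>r\<close> and \<open>s\<^bsub>r+1\<^esub>\<close> with polynomial coefficients,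
  and likewise those in \<open>k\<close>; what is left is an identity of polynomials in six variables.
\<close>

lemma product_form_second_difference:
  "product_form (r + 2) k - 2 * product_form (r + 1) (k + 1) + product_form r (k + 2)
    = - 2 * real (r + k + 2) * (real (r + k + 2) + 1) * (real (r + k + 2) + 2)
        * schr (r + 1) * schr (k + 1)"
proof -
  define x y x' y' u v where "x = schr (r + 1)" and "y = schr r" and "x' = schr (k + 1)" and "y' = schr k"
    and "u = real r" and "v = real k"
  note defs = x_def y_def x'_def y'_def u_def v_def
  note defs' = defs[symmetric]
  have upper: "upper (r + 2) = (3 * (2 * u + 5) * (3 * (2 * u + 3) * x - u * y) - (u + 3) * (u + 1) * x) / 2"
      "upper (r + 1) = (u + 2) * (3 * (2 * u + 3) * x - u * y) / 2" "upper r = (u + 2) * (u + 1) / 2 * x"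
      "upper (k + 2) = (3 * (2 * v + 5) * (3 * (2 * v + 3) * x' - v * y') - (v + 3) * (v + 1) * x') / 2"
      "upper (k + 1) = (v + 2) * (3 * (2 * v + 3) * x' - v * y') / 2" "upper k = (v + 2) * (v + 1) / 2 * x'"
    using upper_Suc_Suc[of r] upper_Suc[of r] upper_Suc_Suc[of k] upper_Suc[of k]
    by (simp_all add: defs upper_def[of r] upper_def[of k])
  have middle: "middle (r + 2) = upper (r + 1)" "middle (r + 1) = upper r" "middle r = (u + 1) * u / 2 * y"
      "middle (k + 2) = upper (k + 1)" "middle (k + 1) = upper k" "middle k = (v + 1) * v / 2 * y'"
    using middle_Suc[of "r + 1"] middle_Suc[of "k + 1"] middle_Suc[of r] middle_Suc[of k]
    by (simp_all add: defs middle_def[of r] middle_def[of k])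
  have lower: "lower (r + 2) = upper r" "lower (r + 1) = middle r"
      "lower r = u * (3 * (2 * u + 1) * y - (u + 2) * x) / 2"
      "lower (k + 2) = upper k" "lower (k + 1) = middle k"
      "lower k = v * (3 * (2 * v + 1) * y' - (v + 2) * x') / 2"
    using lower_Suc[of "r + 1"] lower_Suc[of "k + 1"] lower_Suc[of r] lower_Suc[of k]
      middle_Suc[of r] middle_Suc[of k] lower_eq[of r] lower_eq[of k]
    by (simp_all add: defs)
  show ?thesis
    unfolding product_form_def lower middle upper of_nat_add of_nat_numeral of_nat_1 defs'
    by (simp add: field_simps) 
qed

lemma schr_1: "little_schroeder (Suc 0) = 1"
  using schr_Suc[of 0] by (simp add: schr_0)

lemma shifted_depth_0: "shifted_depth n 0 = schr (n + 1) / 2"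
  by (simp add: shifted_depth_def)

lemma shifted_depth_1: "shifted_depth n 1 = schr (n + 1) - 3 / 2 * schr n"
  by (simp add: shifted_depth_def schr_0)

text \<open>
  The weights \<open>r - i\<close> in the sum are linear in \<open>r\<close> until they reach zero, so that only the corner at
  \<open>i = r + 1\<close> survives.
\<close>

lemma shifted_depth_second_difference:
  "shifted_depth n (r + 2) - 2 * shifted_depth n (r + 1) + shifted_depth n r = - 2 * schr (r + 1) * schr (n - (r + 1))"
proof -
  let ?a = "\<lambda>i. schr i * schr (n - i)"
  have shift: "(\<Sum>i<q. (real (q + 1) - real i) * ?a i) = (\<Sum>i<q. (real q - real i) * ?a i) + (\<Sum>i<q. ?a i)" for q
    unfolding sum.distrib[symmetric] by (intro sum.cong) (auto simp: algebra_simps)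
  have step: "shifted_depth n (q + 1) = shifted_depth n q + schr (Suc n) / 2 + schr n / 2 - 2 * (\<Sum>i<q + 1. ?a i)" for q
    using shift[of q] by (simp add: shifted_depth_def field_simps)
  show ?thesis
    using step[of r] step[of "r + 1"] by simp
qed

text \<open>
  Both sides have the same second differences in \<open>r\<close>, so it suffices to compare them at \<open>r = 0\<close> and
  \<open>r = 1\<close>.
\<close>

lemma shifted_depth_closed_form:
  assumes "n > 0" "r \<le> n"
  shows "real n * (real n + 1) * (real n + 2) * shifted_depth n r = product_form r (n - r)"
  using assms(2)
proof (induction r rule: less_induct)
  case (less r)
  consider "r = 0" | "r = 1" | q where "r = q + 2"
    by (metis One_nat_def Suc_1 add.commute add_Suc_right add_0 not0_implies_Suc)
  then show ?case
  proof cases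
    case 1
    then show ?thesis by (simp add: shifted_depth_0 product_form_def upper_def middle_def lower_def schr_0 schr_1 algebra_simps)
  next
    case 2
    obtain m where n: "n = m + 1" using assms(1) by (cases n) auto
    have rec: "3 * (2 * real m + 3) * schr (m + 1) - real m * schr m = (real m + 3) * schr (m + 2)"
      by (simp only: schr_three_term)
    have one: "little_schroeder 1 = 1" "little_schroeder 2 = 3"
      using schr_Suc[of 0] schr_three_term[of 0] by (simp_all add: schr_0 numeral_2_eq_2)
    have "upper 1 = 9" "middle 1 = 1" "lower 1 = 0"
      by (simp_all add: upper_def middle_def lower_def one schr_1 flip: numeral_2_eq_2)
    then have "product_form 1 m = (real m + 1) * (9 * upper m) - 2 * (real m + 2) * middle m"
      by (simp add: product_form_def algebra_simps)
    also have "\<dots> = (real m + 1) * (real m + 2) * (9 / 2 * (real m + 1) * schr (m + 1) - real m * schr m)"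
      by (simp add: upper_def middle_def field_simps)
    also have "\<dots> = (real m + 1) * (real m + 2) * ((real m + 3) * schr (m + 2) - 3 / 2 * (real m + 3) * schr (m + 1))"
      unfolding rec[symmetric] by (simp add: field_simps)
    also have "\<dots> = (real m + 1) * (real m + 2) * (real m + 3) * shifted_depth n 1"
      unfolding shifted_depth_1 n by (simp add: algebra_simps)
    finally show ?thesis using 2 n by (simp add: algebra_simps)
  next
    case (3 q)
    define l where "l = n - r"
    have n: "n = q + l + 2" "n - (q + 1) = l + 1" "n - q = l + 2" "n - r = l"
      using less.prems 3 by (auto simp: l_def)
    let ?N = "real n * (real n + 1) * (real n + 2)"
    have IH: "?N * shifted_depth n q = product_form q (l + 2)" "?N * shifted_depth n (q + 1) = product_form (q + 1) (l + 1)"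
      using less.IH[of q] less.IH[of "q + 1"] less.prems 3 n by auto
    have "?N * shifted_depth n (q + 2) = 2 * (?N * shifted_depth n (q + 1)) - ?N * shifted_depth n q
        - ?N * (2 * schr (q + 1) * schr (l + 1))"
      using arg_cong[OF shifted_depth_second_difference[of n q], of "\<lambda>x. ?N * x"] unfolding n(2)
      by (simp only: algebra_simps)
    also have "\<dots> = product_form (q + 2) l"
      using product_form_second_difference[of q l] unfolding IH n(1)[symmetric]
      by (simp add: algebra_simps n(1))
    finally show ?thesis using 3 n by simp
  qed
qed

section \<open>Growth of the little Schroeder numbers\<close>

text \<open>
  If \<open>u\<close> decays fast, the convolution only sees terms \<open>a (n - m)\<close> with \<open>m\<close> small, which all behave like
  \<open>L n\<^bsup>-p\<^esup>\<close>. The interchange of limit and sum is dominated convergence (Tannery's theorem).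
\<close>

lemma convolution_asymptotics:
  fixes a u :: "nat \<Rightarrow> real"
  assumes lim: "(\<lambda>n. a n * real n powr p) \<longlonglongrightarrow> L" and p: "p \<ge> 0"
    and summ: "summable (\<lambda>m. \<bar>u m\<bar> * (real m + 1) powr p)"
  shows "(\<lambda>n. (\<Sum>m\<le>n. u m * a (n - m)) * real n powr p) \<longlonglongrightarrow> L * (\<Sum>m. u m)"
proof -
  have shifted: "(\<lambda>n. a n * (real n + real k) powr p) \<longlonglongrightarrow> L" for k
  proof -
    have "(\<lambda>n. (real n + real k) / real n) \<longlonglongrightarrow> 1" by real_asymp
    then have "(\<lambda>n. ((real n + real k) / real n) powr p) \<longlonglongrightarrow> 1 powr p"
      by (intro tendsto_intros) auto
    from tendsto_mult[OF lim this]
    have "(\<lambda>n. a n * real n powr p * ((real n + real k) / real n) powr p) \<longlonglongrightarrow> L"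
      by simp
    moreover have "\<forall>\<^sub>F n in sequentially. a n * real n powr p * ((real n + real k) / real n) powr p
        = a n * (real n + real k) powr p"
      using eventually_gt_at_top[of 0] by eventually_elim (simp add: powr_divide)
    ultimately show ?thesis by (rule Lim_transform_eventually)
  qed
  obtain K where K: "\<And>n. \<bar>a n * (real n + 1) powr p\<bar> \<le> K"
    using convergent_imp_Bseq[OF convergentI[OF shifted[of 1]]] by (auto simp: Bseq_def)
  define f where "f m n = (if m \<le> n then u m * a (n - m) * real n powr p else 0)" for m n
  have bound: "\<bar>f m n\<bar> \<le> K * (\<bar>u m\<bar> * (real m + 1) powr p)" for m n
  proof (cases "m \<le> n")
    case True
    \<comment> \<open>This inequality trades the factor \<open>n\<^sup>p\<close> for \<open>(n - m + 1)\<^sup>p\<close>, absorbed by \<open>a\<close>, and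
      \<open>(m + 1)\<^sup>p\<close>, absorbed by \<open>u\<close>.\<close>
    have "real n \<le> (real (n - m) + 1) * (real m + 1)"
      using le_Suc_ex[OF True] by (auto simp: algebra_simps)
    then have "real n powr p \<le> (real (n - m) + 1) powr p * (real m + 1) powr p"
      using p by (subst powr_mult[symmetric]) (auto intro!: powr_mono2)
    then have "\<bar>f m n\<bar> \<le> \<bar>u m\<bar> * \<bar>a (n - m)\<bar> * ((real (n - m) + 1) powr p * (real m + 1) powr p)"
      using True by (simp add: f_def abs_mult mult_left_mono)
    also have "\<dots> = \<bar>a (n - m) * (real (n - m) + 1) powr p\<bar> * (\<bar>u m\<bar> * (real m + 1) powr p)"
      by (simp add: abs_mult)
    also have "\<dots> \<le> K * (\<bar>u m\<bar> * (real m + 1) powr p)"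
      by (intro mult_right_mono K) auto
    finally show ?thesis .
  next
    case False
    have "0 \<le> K" using K[of 0] by linarith
    then show ?thesis using False by (simp add: f_def)
  qed
  have "(\<lambda>n. f m n) \<longlonglongrightarrow> L * u m" for m
  proof (rule LIMSEQ_offset[of _ m])
    have "(\<lambda>n. a n * (real n + real m) powr p * u m) \<longlonglongrightarrow> L * u m"
      by (intro tendsto_intros shifted)
    then show "(\<lambda>n. f m (n + m)) \<longlonglongrightarrow> L * u m"
      by (simp add: f_def mult_ac)
  qed
  moreover have "\<forall>\<^sub>F (m, n) in at_top \<times>\<^sub>F sequentially. norm (f m n) \<le> K * (\<bar>u m\<bar> * (real m + 1) powr p)"
    using bound by (intro always_eventually) auto
  ultimately have "(\<lambda>n. \<Sum>m. f m n) \<longlonglongrightarrow> (\<Sum>m. L * u m)"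
    by (rule tannerys_theorem[THEN conjunct2, THEN conjunct2])
      (use summable_mult[OF summ, of K] in auto)
  moreover have "(\<Sum>m. f m n) = (\<Sum>m\<le>n. u m * a (n - m)) * real n powr p" for n
    by (subst suminf_finite[of "{..n}"]) (auto simp: f_def sum_distrib_right)
  moreover have "summable u"
  proof (rule summable_comparison_test[OF _ summ], intro exI[of _ 0] allI impI)
    fix m :: nat
    have "1 \<le> (real m + 1) powr p" using p by (intro ge_one_powr_ge_zero) auto
    from mult_left_mono[OF this, of "\<bar>u m\<bar>"]
    show "norm (u m) \<le> \<bar>u m\<bar> * (real m + 1) powr p" by simp
  qed
  ultimately show ?thesis by (simp add: suminf_mult)
qed

text \<open>
  The coefficients of \<open>sqrt (1 - z)\<close>.
\<close>

definition sqrt_coeff :: "nat \<Rightarrow> real" where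
  "sqrt_coeff n = (1 / 2 gchoose n) * (- 1) ^ n"

lemma sqrt_coeff_asymptotics: "(\<lambda>n. sqrt_coeff n * real n powr (3 / 2)) \<longlonglongrightarrow> - 1 / (2 * sqrt pi)"
proof -
  have "Gamma (- 1 / 2 + 1 :: real) = - 1 / 2 * Gamma (- 1 / 2)"
    using fraction_not_in_Ints[of 2 "- 1", where 'a = real] nonpos_Ints_Int[of "- 1 / 2 :: real"]
    by (intro Gamma_plus1) auto
  \<comment> \<open>The coefficients of \<open>(1 - z)\<^bsup>1/2\<^esup>\<close> are asymptotic to \<open>n\<^bsup>-3/2\<^esup> / \<Gamma>(-1/2)\<close>.\<close>
  then have Gamma: "Gamma (- (1 / 2) :: real) = - 2 * sqrt pi"
    using Gamma_one_half_real by simp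
  have "(\<lambda>n. (1 / 2 gchoose n) / ((- 1) ^ n / exp ((1 / 2 + 1) * ln (real n)))) \<longlonglongrightarrow> - 1 / (2 * sqrt pi)"
    using gbinomial_asymptotic[of "1 / 2 :: real"] by (simp add: Gamma field_simps)
  moreover have "\<forall>\<^sub>F n in sequentially. (1 / 2 gchoose n) / ((- 1) ^ n / exp ((1 / 2 + 1) * ln (real n)))
      = sqrt_coeff n * real n powr (3 / 2)"
    using eventually_gt_at_top[of 0]
    by eventually_elim (auto simp: sqrt_coeff_def powr_def uminus_power_if)
  ultimately show ?thesis by (rule Lim_transform_eventually)
qed

lemma sqrt_coeff_sums: "\<bar>x\<bar> < 1 \<Longrightarrow> (\<lambda>n. sqrt_coeff n * x ^ n) sums sqrt (1 - x)"
  using gen_binomial_real[of "- x" "1 / 2"]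
  by (simp add: sqrt_coeff_def powr_half_sqrt power_minus[of x] mult_ac)

lemma summable_sqrt_coeff:
  assumes "0 \<le> x" "x < 1"
  shows "summable (\<lambda>n. \<bar>sqrt_coeff n * x ^ n\<bar> * (real n + 1) powr (3 / 2))"
proof -
  have "(\<lambda>n. sqrt_coeff n * real n powr (3 / 2) * ((real n + 1) / real n) powr (3 / 2)) \<longlonglongrightarrow> - 1 / (2 * sqrt pi) * 1"
    by (intro tendsto_mult sqrt_coeff_asymptotics) real_asymp
  moreover have "\<forall>\<^sub>F n in sequentially. sqrt_coeff n * real n powr (3 / 2) * ((real n + 1) / real n) powr (3 / 2)
      = sqrt_coeff n * (real n + 1) powr (3 / 2)"
    using eventually_gt_at_top[of 0] by eventually_elim (simp add: powr_divide)
  ultimately have conv: "convergent (\<lambda>n. sqrt_coeff n * (real n + 1) powr (3 / 2))"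
    by (blast intro: convergentI Lim_transform_eventually)
  then obtain K where K: "\<And>n. \<bar>sqrt_coeff n * (real n + 1) powr (3 / 2)\<bar> \<le> K"
    using convergent_imp_Bseq[OF conv] by (auto simp: Bseq_def)
  have "summable (\<lambda>n. K * x ^ n)"
    using assms by (intro summable_mult summable_geometric) auto
  then show ?thesis
  proof (rule summable_comparison_test[rotated], intro exI[of _ 0] allI impI)
    fix n
    have "\<bar>sqrt_coeff n * (real n + 1) powr (3 / 2)\<bar> * x ^ n \<le> K * x ^ n"
      using assms by (intro mult_right_mono K) auto
    then show "norm (\<bar>sqrt_coeff n * x ^ n\<bar> * (real n + 1) powr (3 / 2)) \<le> K * x ^ n"
      using assms by (simp add: abs_mult mult_ac)
  qed
qed

lemma sqrt_coeff_gf_square: "Abs_fps (\<lambda>n. sqrt_coeff n * c ^ n) ^ 2 = 1 - fps_const c * fps_X"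
proof -
  have "Abs_fps (\<lambda>n. sqrt_coeff n * c ^ n) = fps_binomial (1 / 2) oo (fps_const (- c) * fps_X)"
    unfolding fps_compose_linear by (simp add: fps_eq_iff sqrt_coeff_def power_minus[of c] mult_ac)
  also have "\<dots> ^ 2 = (fps_binomial (1 / 2) * fps_binomial (1 / 2)) oo (fps_const (- c) * fps_X)"
    by (simp add: power2_eq_square fps_compose_mult_distrib)
  also have "fps_binomial (1 / 2) * fps_binomial (1 / 2 :: real) = 1 + fps_X"
    by (simp add: fps_binomial_1 flip: fps_binomial_add_mult)
  finally show ?thesis by (simp add: fps_compose_add_distrib)
qed

definition radius :: real where "radius = 3 - 2 * sqrt 2"

lemma radius_bounds: "0 < radius" "radius < 1"
proof -
  have "sqrt 2 < sqrt (9 / 4)" by (rule real_sqrt_less_mono) simp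
  also have "sqrt (9 / 4) = (3 / 2 :: real)" by (simp add: real_sqrt_divide)
  finally show "0 < radius" by (simp add: radius_def)
  have "sqrt 1 < sqrt (2 :: real)" by (rule real_sqrt_less_mono) simp
  then show "radius < 1" by (simp add: radius_def)
qed

lemma inverse_radius: "1 / radius = 3 + 2 * sqrt 2"
  using radius_bounds by (simp add: radius_def field_simps)

text \<open>
  The roots of \<open>1 - 6 z + z\<^sup>2\<close> are \<open>\<rho>\<close> and \<open>1 / \<rho>\<close>. Both sides are square roots of this polynomial with
  constant term 1, and an integral domain has only two square roots, which differ in sign.
\<close>

lemma sqrt_gf_factorisation:
  "sqrt_gf = Abs_fps (\<lambda>n. sqrt_coeff n * radius ^ n) * Abs_fps (\<lambda>n. sqrt_coeff n * (1 / radius) ^ n)"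
    (is "_ = ?A * ?B")
proof -
  have "sqrt_gf ^ 2 - (?A * ?B) ^ 2 = 0"
  proof -
    have "(?A * ?B) ^ 2 = (1 - fps_const radius * fps_X) * (1 - fps_const (1 / radius) * fps_X)"
      by (simp only: power_mult_distrib sqrt_coeff_gf_square)
    also have "\<dots> = 1 - fps_const (radius + 1 / radius) * fps_X + fps_const (radius * (1 / radius)) * fps_X ^ 2"
      unfolding fps_const_add[symmetric] fps_const_mult[symmetric] by algebra
    also have "radius + 1 / radius = 6" unfolding inverse_radius by (simp add: radius_def)
    also have "radius * (1 / radius) = 1" using radius_bounds by simp
    finally show ?thesis by (simp add: sqrt_gf_square numeral_fps_const)
  qed
  then have "(sqrt_gf - ?A * ?B) * (sqrt_gf + ?A * ?B) = 0" by algebra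
  moreover have "(sqrt_gf + ?A * ?B) $ 0 \<noteq> 0"
    by (simp add: sqrt_gf_nth sqrt_coeff_def)
  then have "sqrt_gf + ?A * ?B \<noteq> 0" by (metis fps_zero_nth)
  ultimately show ?thesis by simp
qed

lemma sqrt_gf_asymptotics:
  "(\<lambda>n. sqrt_gf $ n * radius ^ n * real n powr (3 / 2)) \<longlonglongrightarrow> - sqrt (1 - radius ^ 2) / (2 * sqrt pi)"
proof -
  have r2: "0 \<le> radius ^ 2" "radius ^ 2 < 1"
    using radius_bounds by (auto intro!: power_less_one_iff[THEN iffD2])
  have regroup: "a * x * (b * z) * w = a * q * b" if "w = x * y" "z * y = 1" "q = x * x"
    for a b q w x y z :: real
    using that by algebra
  have "sqrt_gf $ n * radius ^ n = (\<Sum>m\<le>n. sqrt_coeff m * (radius ^ 2) ^ m * sqrt_coeff (n - m))" for n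
  proof -
    have "sqrt_gf $ n * radius ^ n
        = (\<Sum>m\<le>n. sqrt_coeff m * radius ^ m * (sqrt_coeff (n - m) * (1 / radius) ^ (n - m)) * radius ^ n)"
      by (simp add: sqrt_gf_factorisation fps_mult_nth atLeast0AtMost sum_distrib_right)
    also have "\<dots> = (\<Sum>m\<le>n. sqrt_coeff m * (radius ^ 2) ^ m * sqrt_coeff (n - m))"
    proof (intro sum.cong refl)
      fix m assume "m \<in> {..n}"
      then have "radius ^ n = radius ^ m * radius ^ (n - m)" by (simp flip: power_add)
      moreover have "(1 / radius) ^ (n - m) * radius ^ (n - m) = 1"
        using radius_bounds by (simp flip: power_mult_distrib)
      moreover have "(radius ^ 2) ^ m = radius ^ m * radius ^ m"
        by (simp add: power2_eq_square power_mult_distrib)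
      ultimately show "sqrt_coeff m * radius ^ m * (sqrt_coeff (n - m) * (1 / radius) ^ (n - m)) * radius ^ n
          = sqrt_coeff m * (radius ^ 2) ^ m * sqrt_coeff (n - m)"
        by (rule regroup)
    qed
    finally show ?thesis .
  qed
  moreover have "(\<Sum>m. sqrt_coeff m * (radius ^ 2) ^ m) = sqrt (1 - radius ^ 2)"
    using sqrt_coeff_sums[of "radius ^ 2"] r2 by (simp add: sums_iff)
  ultimately show ?thesis
    using convolution_asymptotics[OF sqrt_coeff_asymptotics _ summable_sqrt_coeff[OF r2]] by simp
qed

text \<open>
  The number \<open>C\<close> in \<open>s\<^sub>n \<sim> C \<rho>\<^bsup>-n\<^esup> n\<^bsup>-3/2\<^esup>\<close>.
\<close>

definition growth_constant :: real where
  "growth_constant = sqrt (1 - radius ^ 2) / (8 * radius * sqrt pi)"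

lemma growth_constant_pos: "growth_constant > 0"
  unfolding growth_constant_def using radius_bounds
  by (intro divide_pos_pos mult_pos_pos) (auto intro!: power_less_one_iff[THEN iffD2])

lemma schr_asymptotics: "(\<lambda>n. schr n * radius ^ n * real n powr (3 / 2)) \<longlonglongrightarrow> growth_constant"
proof -
  have "(\<lambda>n. sqrt_gf $ (n + 1) * radius ^ (n + 1) * real (n + 1) powr (3 / 2) * (real n / real (n + 1)) powr (3 / 2)
        * (- 1 / (4 * radius)))
      \<longlonglongrightarrow> - sqrt (1 - radius ^ 2) / (2 * sqrt pi) * 1 * (- 1 / (4 * radius))"
    by (intro tendsto_mult tendsto_const LIMSEQ_ignore_initial_segment[OF sqrt_gf_asymptotics]) real_asymp
  moreover have "\<forall>\<^sub>F n in sequentially. sqrt_gf $ (n + 1) * radius ^ (n + 1) * real (n + 1) powr (3 / 2)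
        * (real n / real (n + 1)) powr (3 / 2) * (- 1 / (4 * radius)) = schr n * radius ^ n * real n powr (3 / 2)"
    using eventually_gt_at_top[of 0]
  proof eventually_elim
    case (elim n)
    then obtain m where "n = Suc m" by (cases n) auto
    then have "sqrt_gf $ (n + 1) = - 4 * schr n" by (simp add: sqrt_gf_nth)
    moreover have "real (n + 1) powr (3 / 2) * (real n / real (n + 1)) powr (3 / 2) = real n powr (3 / 2)"
      by (simp add: powr_divide)
    ultimately show ?case
      using radius_bounds by (simp add: mult.assoc)
  qed
  ultimately have "(\<lambda>n. schr n * radius ^ n * real n powr (3 / 2)) \<longlonglongrightarrow> - sqrt (1 - radius ^ 2) / (2 * sqrt pi) * 1 * (- 1 / (4 * radius))"
    by (rule Lim_transform_eventually)
  also have "- sqrt (1 - radius ^ 2) / (2 * sqrt pi) * 1 * (- 1 / (4 * radius)) = growth_constant"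
    by (simp add: growth_constant_def)
  finally show ?thesis .
qed

lemma schr_ratio: "(\<lambda>n. schr n / schr (n + i)) \<longlonglongrightarrow> radius ^ i"
proof -
  let ?q = "\<lambda>n. schr n * radius ^ n * real n powr (3 / 2)"
  have "(\<lambda>n. ?q n / ?q (n + i) * (real (n + i) / real n) powr (3 / 2) * radius ^ i)
      \<longlonglongrightarrow> growth_constant / growth_constant * 1 * radius ^ i"
    using growth_constant_pos
    by (intro tendsto_mult tendsto_divide tendsto_const schr_asymptotics
        LIMSEQ_ignore_initial_segment[OF schr_asymptotics]) (auto, real_asymp)
  moreover have "\<forall>\<^sub>F n in sequentially. ?q n / ?q (n + i) * (real (n + i) / real n) powr (3 / 2) * radius ^ i
      = schr n / schr (n + i)"
    using eventually_gt_at_top[of 0]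
    by eventually_elim (use radius_bounds in \<open>simp add: powr_divide power_add\<close>)
  ultimately show ?thesis
    using growth_constant_pos by (simp add: tendsto_cong)
qed

section \<open>The limit for a fixed leaf\<close>

lemma schr_Suc_ratio: "(\<lambda>n. schr (Suc n) / schr n) \<longlonglongrightarrow> 1 / radius"
  using tendsto_divide[OF tendsto_const[of 1] schr_ratio[of 1]] radius_bounds by simp

lemma schr_shift_ratio: "(\<lambda>n. schr (n - i) / schr n) \<longlonglongrightarrow> radius ^ i"
  by (rule LIMSEQ_offset[of _ i]) (simp add: schr_ratio)

lemma avg_leaf_depth_limit:
  "(\<lambda>n. avg_leaf_depth n r) \<longlonglongrightarrow>
     (2 + sqrt 2) * (real r + 1) - 1 - 2 * (\<Sum>i<r. (real r - real i) * radius ^ i * schr i)"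
proof -
  have "(\<lambda>n. (real r + 1) / 2 * (schr (Suc n) / schr n) + real r / 2
        - 2 * (\<Sum>i<r. (real r - real i) * (schr i * (schr (n - i) / schr n))) - 1 / 2)
      \<longlonglongrightarrow> (real r + 1) / 2 * (1 / radius) + real r / 2
        - 2 * (\<Sum>i<r. (real r - real i) * (schr i * radius ^ i)) - 1 / 2"
    by (intro tendsto_intros schr_Suc_ratio schr_shift_ratio)
  moreover have "\<forall>\<^sub>F n in sequentially. (real r + 1) / 2 * (schr (Suc n) / schr n) + real r / 2
        - 2 * (\<Sum>i<r. (real r - real i) * (schr i * (schr (n - i) / schr n))) - 1 / 2 = avg_leaf_depth n r"
    using eventually_ge_at_top[of r]
  proof eventually_elim
    case (elim n)
    then show ?case using schr_pos[of n]
      by (simp add: avg_leaf_depth_shifted_depth shifted_depth_def add_divide_distrib diff_divide_distrib flip: sum_divide_distrib)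
  qed
  ultimately have "(\<lambda>n. avg_leaf_depth n r) \<longlonglongrightarrow> (real r + 1) / 2 * (1 / radius) + real r / 2
        - 2 * (\<Sum>i<r. (real r - real i) * (schr i * radius ^ i)) - 1 / 2"
    by (rule Lim_transform_eventually)
  also have "(real r + 1) / 2 * (1 / radius) + real r / 2 - 2 * (\<Sum>i<r. (real r - real i) * (schr i * radius ^ i)) - 1 / 2
      = (2 + sqrt 2) * (real r + 1) - 1 - 2 * (\<Sum>i<r. (real r - real i) * radius ^ i * schr i)"
    unfolding inverse_radius by (simp add: field_simps)
  finally show ?thesis .
qed

text \<open>
  The closed form divided by \<open>n (n + 1) (n + 2)\<close>. Each product is now divided by two factors of order
  \<open>n\<close>, which makes its size for large \<open>n\<close> visible.
\<close>

lemma shifted_depth_partial_fractions: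
  assumes "n > 0" "r \<le> n"
  shows "shifted_depth n r = upper r * upper (n - r) / ((real n + 1) * (real n + 2))
      - 2 * (middle r * middle (n - r)) / (real n * (real n + 2))
      + lower r * lower (n - r) / (real n * (real n + 1))"
proof -
  define x where "x = real n"
  have x: "x > 0" using assms by (simp add: x_def)
  have "shifted_depth n r = product_form r (n - r) / (x * (x + 1) * (x + 2))"
    unfolding shifted_depth_closed_form[OF assms, symmetric] using x by (simp add: x_def)
  also have "\<dots> = (x * (upper r * upper (n - r)) - 2 * (x + 1) * (middle r * middle (n - r)) + (x + 2) * (lower r * lower (n - r)))
      / (x * (x + 1) * (x + 2))"
    using assms by (simp add: product_form_def x_def)
  also have "\<dots> = upper r * upper (n - r) / ((x + 1) * (x + 2)) - 2 * (middle r * middle (n - r)) / (x * (x + 2))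
      + lower r * lower (n - r) / (x * (x + 1))"
  proof -
    have "x * P / (x * (x + 1) * (x + 2)) = P / ((x + 1) * (x + 2))"
      "2 * (x + 1) * P / (x * (x + 1) * (x + 2)) = 2 * P / (x * (x + 2))"
      "(x + 2) * P / (x * (x + 1) * (x + 2)) = P / (x * (x + 1))" for P
      using x by (simp_all add: divide_simps)
    then show ?thesis by (simp only: add_divide_distrib diff_divide_distrib)
  qed
  finally show ?thesis by (simp only: x_def)
qed

lemma middle_ratio: "(\<lambda>k. middle k / (real (k + a) * real (k + b) * schr (k + r))) \<longlonglongrightarrow> radius ^ r / 2"
proof -
  have "(\<lambda>k. (real k + 1) * real k / (2 * (real (k + a) * real (k + b))) * (schr k / schr (k + r))) \<longlonglongrightarrow> 1 / 2 * radius ^ r"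
    by (intro tendsto_mult schr_ratio) real_asymp
  then show ?thesis by (simp add: middle_def field_simps)
qed

lemma upper_ratio: "(\<lambda>k. upper k / (real (k + r + 1) * real (k + r + 2) * schr (k + r))) \<longlonglongrightarrow> radius ^ r / radius / 2"
proof -
  have "(\<lambda>k. (real k + 2) * (real k + 1) / (2 * (real (k + r + 1) * real (k + r + 2)))
        * (schr (Suc k) / schr k * (schr k / schr (k + r)))) \<longlonglongrightarrow> 1 / 2 * (1 / radius * radius ^ r)"
    by (intro tendsto_mult schr_ratio schr_Suc_ratio) real_asymp
  then show ?thesis using schr_pos by (simp add: upper_def less_imp_neq[symmetric] mult_ac)
qed

lemma lower_ratio: "(\<lambda>k. lower k / (real (k + r) * real (k + r + 1) * schr (k + r))) \<longlonglongrightarrow> radius ^ (r + 1) / 2"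
proof (rule LIMSEQ_offset[of _ 1])
  show "(\<lambda>k. lower (k + 1) / (real (k + 1 + r) * real (k + 1 + r + 1) * schr (k + 1 + r))) \<longlonglongrightarrow> radius ^ (r + 1) / 2"
    using middle_ratio[of "r + 1" "r + 2" "r + 1"] by (simp add: lower_Suc ac_simps)
qed

text \<open>
  In the closed form, the factors that depend on \<open>k = n - r\<close> have limits relative to \<open>s\<^sub>n\<close>.
\<close>

lemma avg_leaf_depth_limit_closed:
  "(\<lambda>n. avg_leaf_depth n r) \<longlonglongrightarrow>
     radius ^ r / radius / 2 * upper r - radius ^ r * middle r + radius ^ (r + 1) / 2 * lower r - 1 / 2"
proof (rule LIMSEQ_offset[of _ r])
  let ?up = "\<lambda>k. upper k / (real (k + r + 1) * real (k + r + 2) * schr (k + r))"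
    and ?mid = "\<lambda>k. middle k / (real (k + r) * real (k + (r + 2)) * schr (k + r))"
    and ?down = "\<lambda>k. lower k / (real (k + r) * real (k + r + 1) * schr (k + r))"
  have "(\<lambda>k. upper r * ?up k - 2 * middle r * ?mid k + lower r * ?down k - 1 / 2)
      \<longlonglongrightarrow> upper r * (radius ^ r / radius / 2) - 2 * middle r * (radius ^ r / 2) + lower r * (radius ^ (r + 1) / 2) - 1 / 2"
    by (intro tendsto_intros upper_ratio middle_ratio lower_ratio)
  also have "upper r * (radius ^ r / radius / 2) - 2 * middle r * (radius ^ r / 2) + lower r * (radius ^ (r + 1) / 2) - 1 / 2
      = radius ^ r / radius / 2 * upper r - radius ^ r * middle r + radius ^ (r + 1) / 2 * lower r - 1 / 2"
    by (simp add: mult_ac)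
  finally have lim: "(\<lambda>k. upper r * ?up k - 2 * middle r * ?mid k + lower r * ?down k - 1 / 2) \<longlonglongrightarrow> \<dots>" .
  have "\<forall>\<^sub>F k in sequentially. upper r * ?up k - 2 * middle r * ?mid k + lower r * ?down k - 1 / 2
      = avg_leaf_depth (k + r) r"
    using eventually_gt_at_top[of 0]
  proof eventually_elim
    case (elim k)
    then have "avg_leaf_depth (k + r) r = (upper r * upper k / ((real (k + r) + 1) * (real (k + r) + 2))
        - 2 * (middle r * middle k) / (real (k + r) * (real (k + r) + 2))
        + lower r * lower k / (real (k + r) * (real (k + r) + 1))) / schr (k + r) - 1 / 2"
      by (simp only: avg_leaf_depth_shifted_depth[of r "k + r"] shifted_depth_partial_fractions[of "k + r" r]) simp
    moreover have "real (k + r + 1) = real (k + r) + 1" "real (k + r + 2) = real (k + r) + 2"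
      "real (k + (r + 2)) = real (k + r) + 2"
      by simp_all
    ultimately show ?case
      by (simp only: add_divide_distrib diff_divide_distrib) simp
  qed
  with lim show "(\<lambda>k. avg_leaf_depth (k + r) r)
      \<longlonglongrightarrow> radius ^ r / radius / 2 * upper r - radius ^ r * middle r + radius ^ (r + 1) / 2 * lower r - 1 / 2"
    by (rule Lim_transform_eventually)
qed

section \<open>Leaves far from both ends\<close>

text \<open>
  The three sequences are shifts of each other, so \<open>upper\<close> and \<open>lower\<close> differ from \<open>middle\<close> by a factor
  \<open>1 / \<rho>\<close> and \<open>\<rho>\<close> in the limit.
\<close>

lemma middle_asymptotics: "(\<lambda>m. middle m * radius ^ m / sqrt (real m)) \<longlonglongrightarrow> growth_constant / 2"
proof -
  have "(\<lambda>m. schr m * radius ^ m * real m powr (3 / 2)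
        * ((real m + 1) * real m / (2 * sqrt (real m) * real m powr (3 / 2)))) \<longlonglongrightarrow> growth_constant * (1 / 2)"
    by (intro tendsto_mult schr_asymptotics) real_asymp
  moreover have "\<forall>\<^sub>F m in sequentially. schr m * radius ^ m * real m powr (3 / 2)
        * ((real m + 1) * real m / (2 * sqrt (real m) * real m powr (3 / 2))) = middle m * radius ^ m / sqrt (real m)"
    using eventually_gt_at_top[of 0] by eventually_elim (simp add: middle_def)
  ultimately show ?thesis
    by (simp add: Lim_transform_eventually)
qed

lemma upper_asymptotics: "(\<lambda>m. upper m * radius ^ m / sqrt (real m)) \<longlonglongrightarrow> growth_constant / 2 / radius"
proof -
  have "(\<lambda>m. middle (Suc m) * radius ^ Suc m / sqrt (real (Suc m)) * sqrt (real (Suc m) / real m) / radius)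
      \<longlonglongrightarrow> growth_constant / 2 * 1 / radius"
    using radius_bounds
    by (intro tendsto_mult tendsto_divide tendsto_const LIMSEQ_Suc[OF middle_asymptotics]) (real_asymp, simp)
  moreover have "\<forall>\<^sub>F m in sequentially. middle (Suc m) * radius ^ Suc m / sqrt (real (Suc m))
      * sqrt (real (Suc m) / real m) / radius = upper m * radius ^ m / sqrt (real m)"
    using eventually_gt_at_top[of 0]
    by eventually_elim (use radius_bounds in \<open>simp add: middle_Suc real_sqrt_divide del: of_nat_Suc\<close>)
  ultimately show ?thesis
    by (simp add: Lim_transform_eventually)
qed

lemma lower_asymptotics: "(\<lambda>m. lower m * radius ^ m / sqrt (real m)) \<longlonglongrightarrow> growth_constant / 2 * radius"
proof (rule LIMSEQ_imp_Suc)
  have "(\<lambda>m. middle m * radius ^ m / sqrt (real m) * sqrt (real m / real (Suc m)) * radius)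
      \<longlonglongrightarrow> growth_constant / 2 * 1 * radius"
    by (intro tendsto_mult tendsto_const middle_asymptotics) real_asymp
  moreover have "\<forall>\<^sub>F m in sequentially. middle m * radius ^ m / sqrt (real m) * sqrt (real m / real (Suc m)) * radius
      = lower (Suc m) * radius ^ Suc m / sqrt (real (Suc m))"
    using eventually_gt_at_top[of 0]
    by eventually_elim (simp add: lower_Suc real_sqrt_divide del: of_nat_Suc)
  ultimately show "(\<lambda>m. lower (Suc m) * radius ^ Suc m / sqrt (real (Suc m))) \<longlonglongrightarrow> growth_constant / 2 * radius"
    by (simp add: Lim_transform_eventually)
qed

text \<open>
  All three products in the closed form are of the same order \<open>\<rho>\<^bsup>-n\<^esup> sqrt (r k)\<close>, with the factors
  \<open>1/\<rho>\<^sup>2\<close>, \<open>-2\<close> and \<open>\<rho>\<^sup>2\<close>. They add up to \<open>(1/\<rho> - \<rho>)\<^sup>2 = 32\<close>, so the leading terms do not cancel.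
\<close>

lemma shifted_depth_asymptotics:
  fixes r :: "nat \<Rightarrow> nat"
  assumes le: "\<And>n. r n \<le> n"
    and r: "filterlim r at_top sequentially" and k: "filterlim (\<lambda>n. n - r n) at_top sequentially"
  shows "(\<lambda>n. shifted_depth n (r n) / schr n / sqrt (real (r n) * real (n - r n) / real n)) \<longlonglongrightarrow> 8 * growth_constant"
proof -
  define k where "k n = n - r n" for n
  define \<alpha> \<beta> \<gamma> where "\<alpha> m = upper m * radius ^ m / sqrt (real m)" and "\<beta> m = middle m * radius ^ m / sqrt (real m)"
    and "\<gamma> m = lower m * radius ^ m / sqrt (real m)" for m
  let ?q = "\<lambda>n. schr n * radius ^ n * real n powr (3 / 2)" and ?C = growth_constant
  have k': "filterlim k at_top sequentially" using k by (simp add: k_def[abs_def])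
  have "(\<lambda>n. (\<alpha> (r n) * \<alpha> (k n) * (real n ^ 2 / ((real n + 1) * (real n + 2)))
        - 2 * (\<beta> (r n) * \<beta> (k n)) * (real n ^ 2 / (real n * (real n + 2)))
        + \<gamma> (r n) * \<gamma> (k n) * (real n ^ 2 / (real n * (real n + 1)))) / ?q n)
      \<longlonglongrightarrow> (?C / 2 / radius * (?C / 2 / radius) * 1 - 2 * (?C / 2 * (?C / 2)) * 1
        + ?C / 2 * radius * (?C / 2 * radius) * 1) / ?C"
    unfolding \<alpha>_def \<beta>_def \<gamma>_def
    using growth_constant_pos
    by (intro tendsto_divide tendsto_add tendsto_diff tendsto_mult tendsto_const schr_asymptotics
        filterlim_compose[OF upper_asymptotics] filterlim_compose[OF middle_asymptotics]
        filterlim_compose[OF lower_asymptotics] r k') (real_asymp, real_asymp, real_asymp, simp)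
  moreover have "\<forall>\<^sub>F n in sequentially. (\<alpha> (r n) * \<alpha> (k n) * (real n ^ 2 / ((real n + 1) * (real n + 2)))
        - 2 * (\<beta> (r n) * \<beta> (k n)) * (real n ^ 2 / (real n * (real n + 2)))
        + \<gamma> (r n) * \<gamma> (k n) * (real n ^ 2 / (real n * (real n + 1)))) / ?q n
      = shifted_depth n (r n) / schr n / sqrt (real (r n) * real (n - r n) / real n)"
    using eventually_gt_at_top[of 0] eventually_compose_filterlim[OF eventually_gt_at_top[of 0] r]
      eventually_compose_filterlim[OF eventually_gt_at_top[of 0] k']
  proof eventually_elim
    case (elim n)
    define w where "w = radius ^ n / (sqrt (real (r n)) * sqrt (real (k n)))"
    have n: "n = r n + k n" using le[of n] by (simp add: k_def)
    have pow: "radius ^ r n * radius ^ k n = radius ^ n" by (subst (3) n) (simp add: power_add)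
    have prods: "\<alpha> (r n) * \<alpha> (k n) = upper (r n) * upper (k n) * w"
      "\<beta> (r n) * \<beta> (k n) = middle (r n) * middle (k n) * w" "\<gamma> (r n) * \<gamma> (k n) = lower (r n) * lower (k n) * w"
      by (simp_all add: \<alpha>_def \<beta>_def \<gamma>_def w_def pow[symmetric])
    have "real n powr (3 / 2) = real n * sqrt (real n)"
      using elim powr_add[of "real n" 1 "1 / 2"] by (simp add: powr_half_sqrt)
    moreover have "real n = sqrt (real n) * sqrt (real n)" by simp
    ultimately have scale: "w * real n ^ 2 / ?q n = 1 / schr n / sqrt (real (r n) * real (k n) / real n)"
      using elim radius_bounds schr_pos[of n]
      by (simp add: w_def real_sqrt_mult real_sqrt_divide power2_eq_square field_simps)
    have "(\<alpha> (r n) * \<alpha> (k n) * (real n ^ 2 / ((real n + 1) * (real n + 2)))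
        - 2 * (\<beta> (r n) * \<beta> (k n)) * (real n ^ 2 / (real n * (real n + 2)))
        + \<gamma> (r n) * \<gamma> (k n) * (real n ^ 2 / (real n * (real n + 1)))) / ?q n
        = shifted_depth n (r n) * (w * real n ^ 2 / ?q n)"
      unfolding shifted_depth_partial_fractions[OF elim(1) le] prods k_def[symmetric]
      by (simp add: add_divide_distrib diff_divide_distrib ring_distribs mult_ac)
    then show ?case unfolding scale by (simp add: k_def)
  qed
  ultimately have "(\<lambda>n. shifted_depth n (r n) / schr n / sqrt (real (r n) * real (n - r n) / real n))
      \<longlonglongrightarrow> (?C / 2 / radius * (?C / 2 / radius) * 1 - 2 * (?C / 2 * (?C / 2)) * 1
        + ?C / 2 * radius * (?C / 2 * radius) * 1) / ?C"
    by (rule Lim_transform_eventually)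
  also have "(?C / 2 / radius * (?C / 2 / radius) * 1 - 2 * (?C / 2 * (?C / 2)) * 1
        + ?C / 2 * radius * (?C / 2 * radius) * 1) / ?C = ?C / 4 * (1 / radius - radius) ^ 2"
    using growth_constant_pos radius_bounds by (simp add: field_simps power2_eq_square)
  also have "(1 / radius - radius) ^ 2 = 32"
    unfolding inverse_radius by (simp add: radius_def power2_eq_square algebra_simps)
  finally show ?thesis by simp
qed

text \<open>
  The summand \<open>-1/2\<close> is negligible against \<open>sqrt (r k / n)\<close>, because \<open>n / (r k) = 1/r + 1/k \<longlonglongrightarrow> 0\<close>.
\<close>

lemma avg_leaf_depth_asymptotics:
  fixes r :: "nat \<Rightarrow> nat"
  assumes le: "\<And>n. r n \<le> n"
    and r: "filterlim r at_top sequentially" and k: "filterlim (\<lambda>n. n - r n) at_top sequentially"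
  shows "(\<lambda>n. avg_leaf_depth n (r n)) \<sim>[sequentially]
    (\<lambda>n. 8 * growth_constant * sqrt (real (r n) * (1 - real (r n) / real n)))"
proof (rule asymp_equivI')
  let ?w = "\<lambda>n. sqrt (real (r n) * real (n - r n) / real n)"
  have inv: "(\<lambda>n. 1 / real (f n)) \<longlonglongrightarrow> 0" if "filterlim f at_top sequentially" for f :: "nat \<Rightarrow> nat"
    by (rule filterlim_compose[OF lim_1_over_n that])
  have "(\<lambda>n. shifted_depth n (r n) / schr n / ?w n / (8 * growth_constant)
        - sqrt (1 / real (r n) + 1 / real (n - r n)) / (16 * growth_constant))
      \<longlonglongrightarrow> 8 * growth_constant / (8 * growth_constant) - sqrt (0 + 0) / (16 * growth_constant)"
    using growth_constant_pos
    by (intro tendsto_intros shifted_depth_asymptotics assms inv) auto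
  then have "(\<lambda>n. shifted_depth n (r n) / schr n / ?w n / (8 * growth_constant)
        - sqrt (1 / real (r n) + 1 / real (n - r n)) / (16 * growth_constant)) \<longlonglongrightarrow> 1"
    using growth_constant_pos by simp
  moreover have "\<forall>\<^sub>F n in sequentially. shifted_depth n (r n) / schr n / ?w n / (8 * growth_constant)
        - sqrt (1 / real (r n) + 1 / real (n - r n)) / (16 * growth_constant)
      = avg_leaf_depth n (r n) / (8 * growth_constant * sqrt (real (r n) * (1 - real (r n) / real n)))"
    using eventually_gt_at_top[of 0] eventually_compose_filterlim[OF eventually_gt_at_top[of 0] r]
      eventually_compose_filterlim[OF eventually_gt_at_top[of 0] k]
  proof eventually_elim
    case (elim n)
    have "1 / real (r n) + 1 / real (n - r n) = 1 / (real (r n) * real (n - r n) / real n)"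
      using elim le[of n] by (simp add: of_nat_diff field_simps)
    then have "sqrt (1 / real (r n) + 1 / real (n - r n)) = 1 / ?w n"
      by (simp only: real_sqrt_divide real_sqrt_one)
    moreover have "real (r n) * (1 - real (r n) / real n) = real (r n) * real (n - r n) / real n"
      using elim le[of n] by (simp add: of_nat_diff field_simps)
    ultimately show ?case
      using avg_leaf_depth_shifted_depth[OF le[of n]] by (simp add: diff_divide_distrib mult_ac)
  qed
  ultimately show "(\<lambda>n. avg_leaf_depth n (r n) / (8 * growth_constant * sqrt (real (r n) * (1 - real (r n) / real n))))
      \<longlonglongrightarrow> 1"
    by (rule Lim_transform_eventually)
qed

theorem theorem4p3:
  fixes \<rho> :: real and s :: "nat \<Rightarrow> real"
  assumes rho: "\<rho> = 3 - 2 * sqrt 2"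
    and s: "s = (\<lambda>n. real (little_schroeder n))"
  shows
    "(\<forall>n r. r \<le> n \<longrightarrow>
        avg_leaf_depth n r =
          (real r + 1) * s (n + 1) / (2 * s n) + (real r - 1) / 2
            - 2 / s n * (\<Sum>i<r. (real r - real i) * s i * s (n - i)))
     \<and> (\<forall>r.
        (\<lambda>n. avg_leaf_depth n r) \<longlonglongrightarrow>
          (2 + sqrt 2) * (real r + 1) - 1 - 2 * (\<Sum>i<r. (real r - real i) * \<rho> ^ i * s i)
        \<and> (2 + sqrt 2) * (real r + 1) - 1 - 2 * (\<Sum>i<r. (real r - real i) * \<rho> ^ i * s i) =
          \<rho> powi (int r - 1) / 2 * real ((r + 2) choose 2) * s (r + 1)
            - \<rho> ^ r * real ((r + 1) choose 2) * s r
            + \<rho> ^ (r + 1) / 2 * real (r choose 2) * s (r - 1)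
            - 1 / 2)
     \<and> (\<forall>r :: nat \<Rightarrow> nat.
        (\<forall>n. r n \<le> n) \<longrightarrow>
        filterlim r at_top sequentially \<longrightarrow>
        filterlim (\<lambda>n. n - r n) at_top sequentially \<longrightarrow>
        (\<lambda>n. avg_leaf_depth n (r n)) \<sim>[sequentially]
          (\<lambda>n. sqrt (1 - \<rho>\<^sup>2) / (\<rho> * sqrt pi)
                 * sqrt (real (r n) * (1 - real (r n) / real n))))"
proof (intro conjI allI impI)
  have \<rho>: "\<rho> = radius" unfolding rho radius_def ..
  show "avg_leaf_depth n r =
      (real r + 1) * s (n + 1) / (2 * s n) + (real r - 1) / 2
        - 2 / s n * (\<Sum>i<r. (real r - real i) * s i * s (n - i))" if "r \<le> n" for n r
    using schr_pos[of n] unfolding avg_leaf_depth_shifted_depth[OF that] shifted_depth_def s mult.assoc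
    by (simp add: field_simps)
  show lim: "(\<lambda>n. avg_leaf_depth n r) \<longlonglongrightarrow>
      (2 + sqrt 2) * (real r + 1) - 1 - 2 * (\<Sum>i<r. (real r - real i) * \<rho> ^ i * s i)" for r
    unfolding \<rho> s by (rule avg_leaf_depth_limit)
  show "(2 + sqrt 2) * (real r + 1) - 1 - 2 * (\<Sum>i<r. (real r - real i) * \<rho> ^ i * s i) =
      \<rho> powi (int r - 1) / 2 * real ((r + 2) choose 2) * s (r + 1)
        - \<rho> ^ r * real ((r + 1) choose 2) * s r
        + \<rho> ^ (r + 1) / 2 * real (r choose 2) * s (r - 1)
        - 1 / 2" (is "_ = ?closed") for r
  \<comment> \<open>Both sides are limits of the average depth.\<close>
  proof (rule LIMSEQ_unique[OF lim])
    have choose: "real (m choose 2) = real m * (real m - 1) / 2" for m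
      by (induction m) (simp_all add: numeral_2_eq_2 field_simps)
    have "upper r = real ((r + 2) choose 2) * s (r + 1)" "middle r = real ((r + 1) choose 2) * s r"
      "lower r = real (r choose 2) * s (r - 1)"
      unfolding choose s upper_def middle_def lower_def by (simp_all add: algebra_simps)
    moreover have "\<rho> powi (int r - 1) = radius ^ r / radius"
      using radius_bounds unfolding \<rho> by (simp add: power_int_diff)
    ultimately show "(\<lambda>n. avg_leaf_depth n r) \<longlonglongrightarrow> ?closed"
      using avg_leaf_depth_limit_closed[of r] unfolding \<rho> by (simp only: mult.assoc)
  qed
  show "(\<lambda>n. avg_leaf_depth n (r n)) \<sim>[sequentially]
      (\<lambda>n. sqrt (1 - \<rho>\<^sup>2) / (\<rho> * sqrt pi) * sqrt (real (r n) * (1 - real (r n) / real n)))"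
    if "\<forall>n. r n \<le> n" "filterlim r at_top sequentially" "filterlim (\<lambda>n. n - r n) at_top sequentially"
    for r :: "nat \<Rightarrow> nat"
  proof -
    have "8 * growth_constant = sqrt (1 - \<rho>\<^sup>2) / (\<rho> * sqrt pi)"
      by (simp add: growth_constant_def \<rho>)
    then show ?thesis using avg_leaf_depth_asymptotics[of r] that by simp
  qed
qed

end
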